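(* Consider a one-dimensional network of elastoplastic springs as described in the context, and assume in addition: (i) the number of displacement-controlled loadings is $q=n-2$; (ii) no spring is blocked by the displacement-controlled loadings; (iii) the loadings $l$ and $\bar h$ are $T$-periodic and Lipschitz continuous. Let $\bar u$ be a nonzero vector of $U$ (under (i), $\dim U=1$), and let $\bar c^{+},\bar c^{-}\in\mathbb{R}^m$ be defined by $\bar c^{+}_i=c_i^{\operatorname{sign}(\bar u_i)}$, $\bar c^{-}_i=c_i^{-\operatorname{sign}(\bar u_i)}$, where $c_i^{+1}:=c_i^+$ and $c_i^{-1}:=c_i^-$; write $\bar c^{+1}:=\bar c^+$, $\bar c^{-1}:=\bar c^-$. Assume that the stress loading is large in the sense that for at least one $k\in\{-1,+1\}$, $$\Big\langle\bar u,\ (\bar c^{k}_1,\dots,\bar c^{k}_{j-1},\bar c^{-k}_j,\bar c^{k}_{j+1},\dots,\bar c^{k}_m)^\top+Ah(t)\Big\rangle\cdot\big\langle\bar u,\ \bar c^k+Ah(t)\big\rangle\le 0\quad\text{for all } j\in\{1,\dots,m\},\ t\in[0,T],$$ and that the displacement-controlled loading is large in the sense that $$\|A^{-1}c^- - A^{-1}c^+\|_A<\|g(t_1)-g(t_2)\|_A\quad\text{for some }0\le t_1<t_2,$$ where $c^\pm=(c_1^\pm,\dots,c_m^\pm)^\top$ and $\|x\|_A=\sqrt{\langle x,Ax\rangle}$. Then there exists a $T$-periodic function $s_0:[0,\infty)\to\mathbb{R}^m$ such that $\|s(t)-s_0(t)\|\to 0$ as $t\to\infty$ for the stress component $s$ of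 any solution $(s,e,p,r)$ of the variational system on $[0,\infty)$.
   Context: Network: $n$ nodes with displacements $\xi\in\mathbb{R}^n$ and $m$ springs; spring $k$ joins a left node $i_k$ to a right node $j_k\neq i_k$, and the graph formed by the nodes and springs is connected. The kinematic matrix $D$ is the $m\times n$ matrix with $(D\xi)_k=\xi_{j_k}-\xi_{i_k}$. $A=\mathrm{diag}(a_1,\dots,a_m)$ with $a_k>0$ (Hooke coefficients); $c_k^-<c_k^+$ are elastic limits, $C=\prod_{k=1}^m[c_k^-,c_k^+]\subset\mathbb{R}^m$, and $N_C(x)=\{\zeta:\langle\zeta,c-x\rangle\le0\ \forall c\in C\}$ if $x\in C$, $N_C(x)=\emptyset$ otherwise. There are $q$ displacement-controlled loadings: the $k$-th prescribes $\xi_{J_k}-\xi_{I_k}=l_k(t)$ for given nodes $I_k,J_k$; $R^k\in\{-1,0,1\}^m$ is the signed incidence vector of a chain of springs from $I_k$ to $J_k$, so that $(R^k)^\top D\xi=\xi_{J_k}-\xi_{I_k}$ for all $\xi$; $R=(R^1,\dots,R^q)$ ($m\times q$); it is assumed that $\mathrm{rank}(R^\top D)=q$. The stress-controlled loading (external nodal forces) is $f(t)=-D^\top\bar h(t)$ with $\bar h:\mathbb{R}\to\mathbb{R}^m$ continuous. Variational system for $s,e,p\in\mathbb{R}^m$, $r\in\mathbb{R}^q$: $s=Ae$, $\dot p\in N_C(s)$, $e+p\in D\mathbb{R}^n$, $R^\top(e+p)=l(t)$, $\sum_{k=1}^m s_k s^k+\sum_{k=1}^q r_k r^k+f(t)=0$,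 where $s^k\in\mathbb{R}^n$ has entries $s^k_{i_k}=1$, $s^k_{j_k}=-1$ and $0$ otherwise, and $r^k\in\mathbb{R}^n$ has $r^k_{I_k}=1$, $r^k_{J_k}=-1$ and $0$ otherwise; solutions are absolutely continuous and satisfy the relations a.e. Let $L$ be an $n\times q$ matrix with $R^\top D L=I_{q}$. $U=\{x\in D\mathbb{R}^n: R^\top x=0\}$, $U^\perp$ its Euclidean orthogonal complement, $V=A^{-1}U^\perp$; $\mathbb{R}^m=U\oplus V$ is orthogonal for $(u,v)_A=\langle u,Av\rangle$, and $P_U,P_V$ are the corresponding projections. Effective loadings: $g(t)=P_VDL\,l(t)$, $h(t)=P_UA^{-1}\bar h(t)$. A spring is blocked by the displacement-controlled loadings if its two endpoints are connected by a chain of pairs $\{I_k,J_k\}$ of displacement-controlled loadings. *)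

theory Defs
  imports "HOL-Analysis.Analysis"
begin

text \<open>Nodes are indexed by a finite type 'n, springs by a finite type 'm.
  Spring k joins left node ii k to right node jj k.  The displacement-controlled
  loadings are indexed by the naturals k < q (so that q = 0 is allowed).\<close>

definition kin_matrix :: "('m::finite \<Rightarrow> 'n::finite) \<Rightarrow> ('m \<Rightarrow> 'n) \<Rightarrow> real^'n^'m" where
  "kin_matrix ii jj = (\<chi> k v. (if v = jj k then 1 else 0) - (if v = ii k then 1 else 0))"

definition diag_mat :: "real^'m::finite \<Rightarrow> real^'m^'m" where
  "diag_mat a = (\<chi> i j. if i = j then a $ i else 0)"

definition box :: "real^'m::finite \<Rightarrow> real^'m \<Rightarrow> (real^'m) set" where
  "box cm cp = {x. \<forall>i. cm $ i \<le> x $ i \<and> x $ i \<le> cp $ i}"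

definition normal_cone :: "(real^'m::finite) set \<Rightarrow> real^'m \<Rightarrow> (real^'m) set" where
  "normal_cone C x = (if x \<in> C then {\<zeta>. \<forall>c\<in>C. \<zeta> \<bullet> (c - x) \<le> 0} else {})"

text \<open>The graph of nodes and springs is connected.\<close>
definition graph_connected :: "('m::finite \<Rightarrow> 'n::finite) \<Rightarrow> ('m \<Rightarrow> 'n) \<Rightarrow> bool" where
  "graph_connected ii jj \<longleftrightarrow>
     (let E = range (\<lambda>k. (ii k, jj k)) in \<forall>u v. (u, v) \<in> (E \<union> E\<inverse>)\<^sup>*)"

text \<open>Spring k is blocked by the displacement-controlled loadings: its endpoints are
  connected by a chain of pairs {II k', JJ k'}, k' < q.\<close>
definition blocked :: "nat \<Rightarrow> (nat \<Rightarrow> 'n) \<Rightarrow> (nat \<Rightarrow> 'n) \<Rightarrow> ('m \<Rightarrow> 'n) \<Rightarrow> ('m \<Rightarrow> 'n) \<Rightarrow> 'm \<Rightarrow> bool" where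
  "blocked q II JJ ii jj k \<longleftrightarrow>
     (let F = (\<lambda>k'. (II k', JJ k')) ` {..<q} in (ii k, jj k) \<in> (F \<union> F\<inverse>)\<^sup>*)"

definition spaceU :: "real^'n::finite^'m::finite \<Rightarrow> (nat \<Rightarrow> real^'m) \<Rightarrow> nat \<Rightarrow> (real^'m) set" where
  "spaceU D R q = {x. (\<exists>\<xi>. x = D *v \<xi>) \<and> (\<forall>k<q. R k \<bullet> x = 0)}"

text \<open>V = A^{-1} (U^perp), U^perp the Euclidean orthogonal complement.\<close>
definition spaceV :: "real^'m::finite^'m \<Rightarrow> (real^'m) set \<Rightarrow> (real^'m) set" where
  "spaceV A U = (\<lambda>y. matrix_inv A *v y) ` {y. \<forall>x\<in>U. x \<bullet> y = 0}"

text \<open>Projections associated with the decomposition R^m = U (+) V.\<close>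
definition projU :: "(real^'m::finite) set \<Rightarrow> (real^'m) set \<Rightarrow> real^'m \<Rightarrow> real^'m" where
  "projU U V x = (THE u. u \<in> U \<and> x - u \<in> V)"

definition projV :: "(real^'m::finite) set \<Rightarrow> (real^'m) set \<Rightarrow> real^'m \<Rightarrow> real^'m" where
  "projV U V x = (THE v. v \<in> V \<and> x - v \<in> U)"

definition normA :: "real^'m::finite^'m \<Rightarrow> real^'m \<Rightarrow> real" where
  "normA A x = sqrt (x \<bullet> (A *v x))"

text \<open>Absolute continuity on a compact interval [a,b] (standard epsilon-delta definition).\<close>
definition abs_cont_on :: "real \<Rightarrow> real \<Rightarrow> (real \<Rightarrow> 'a::real_normed_vector) \<Rightarrow> bool" where
  "abs_cont_on a b f \<longleftrightarrow>
     (\<forall>\<epsilon>>0. \<exists>\<delta>>0. \<forall>(N::nat) (x::nat \<Rightarrow> real) (y::nat \<Rightarrow> real).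
        (\<forall>k<N. a \<le> x k \<and> x k \<le> y k \<and> y k \<le> b) \<and>
        (\<forall>k<N. \<forall>k'<N. k \<noteq> k' \<longrightarrow> y k \<le> x k' \<or> y k' \<le> x k) \<and>
        (\<Sum>k<N. y k - x k) < \<delta>
        \<longrightarrow> (\<Sum>k<N. norm (f (y k) - f (x k))) < \<epsilon>)"

text \<open>s^k and r^k.\<close>
definition spring_vec :: "('m::finite \<Rightarrow> 'n::finite) \<Rightarrow> ('m \<Rightarrow> 'n) \<Rightarrow> 'm \<Rightarrow> real^'n" where
  "spring_vec ii jj k = (\<chi> v. if v = ii k then 1 else if v = jj k then -1 else 0)"

definition load_vec :: "(nat \<Rightarrow> 'n::finite) \<Rightarrow> (nat \<Rightarrow> 'n) \<Rightarrow> nat \<Rightarrow> real^'n" where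
  "load_vec II JJ k = (\<chi> v. if v = II k then 1 else if v = JJ k then -1 else 0)"

text \<open>(s,e,p,r) is a solution of the variational system on [0,infinity):
  absolutely continuous on every [0,b], relations a.e. on [0,infinity).\<close>
definition is_solution ::
  "('m::finite \<Rightarrow> 'n::finite) \<Rightarrow> ('m \<Rightarrow> 'n) \<Rightarrow> real^'m \<Rightarrow> real^'m \<Rightarrow> real^'m \<Rightarrow>
   nat \<Rightarrow> (nat \<Rightarrow> 'n) \<Rightarrow> (nat \<Rightarrow> 'n) \<Rightarrow> (nat \<Rightarrow> real^'m) \<Rightarrow>
   (real \<Rightarrow> nat \<Rightarrow> real) \<Rightarrow> (real \<Rightarrow> real^'m) \<Rightarrow>
   (real \<Rightarrow> real^'m) \<Rightarrow> (real \<Rightarrow> real^'m) \<Rightarrow> (real \<Rightarrow> real^'m) \<Rightarrow> (real \<Rightarrow> nat \<Rightarrow> real) \<Rightarrow> bool"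
  where
  "is_solution ii jj a cm cp q II JJ R l hbar s e p r \<longleftrightarrow>
     (let D = kin_matrix ii jj; A = diag_mat a in
       (\<forall>b\<ge>0. abs_cont_on 0 b s \<and> abs_cont_on 0 b e \<and> abs_cont_on 0 b p \<and>
               (\<forall>k<q. abs_cont_on 0 b (\<lambda>t. r t k))) \<and>
       (AE t in lebesgue. t \<ge> 0 \<longrightarrow>
          s t = A *v e t \<and>
          p differentiable (at t) \<and>
          vector_derivative p (at t) \<in> normal_cone (box cm cp) (s t) \<and>
          (\<exists>\<xi>. e t + p t = D *v \<xi>) \<and>
          (\<forall>k<q. R k \<bullet> (e t + p t) = l t k) \<and>
          (\<Sum>k\<in>UNIV. s t $ k *\<^sub>R spring_vec ii jj k) + (\<Sum>k<q. r t k *\<^sub>R load_vec II JJ k)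
            + (- (transpose D *v hbar t)) = 0))"

text \<open>bar c^k with c_i^{+1} = c_i^+, c_i^{-1} = c_i^-; bar c^k_i = c_i^{k sign(u_i)}.
  (Components with u_i = 0 are irrelevant since they are multiplied by u_i = 0.)\<close>
definition cbar :: "real^'m::finite \<Rightarrow> real^'m \<Rightarrow> real^'m \<Rightarrow> real \<Rightarrow> real^'m" where
  "cbar cm cp u k = (\<chi> i. if k * sgn (u $ i) = 1 then cp $ i else cm $ i)"

end

theory Submission
  imports Defs
begin

text \<open>
  Under the hypotheses, \<open>U\<close> is spanned by one vector \<open>u\<close> without zero entries, so the stress is confined to
  the slice \<open>u \<bullet> s = - u \<bullet> hbar\<close> of the box \<open>C\<close>.  The size of the stress loading makes this slice a simplex near
  a vertex \<open>c\<close> of \<open>C\<close>: the coordinates \<open>\<sigma> $ j = u $ j * (c $ j - s $ j)\<close> are nonnegative and have a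
  prescribed sum \<open>\<rho>\<close>.

  Let \<open>\<Phi>\<close> be the sum of the \<open>\<bar>\<sigma>1 $ j - \<sigma>2 $ j\<bar>\<close> for two solutions.  In these coordinates \<open>\<Phi>\<close> is nonincreasing and
  its decrease controls the variation of every difference \<open>\<sigma>1 $ j - \<sigma>2 $ j\<close>.  The size of the
  displacement loading forces every \<open>\<sigma> $ j\<close> to vanish at some time in each window of a fixed number of periods;
  there the difference has changed sign or vanished.  So \<open>\<Phi>\<close> shrinks by a fixed
  factor in each window, and the time shifts of one solution by multiples of the period form a uniform Cauchy
  sequence whose limit is the attractor.  No existence theorem for solutions is needed.
\<close>

text \<open>The simplex shape gives the differences their signs. If
  \<open>\<sigma>1 $ j > \<sigma>2 $ j\<close>, the first solution is off the facet and cannot have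
  a positive rate in direction \<open>j\<close>; the second cannot have a negative one, since that
  would put it at the vertex where \<open>\<sigma>2 $ j\<close> is maximal. So, apart from the
  multiplier, no positive difference grows and no negative one falls. The multiplier pulls all
  coordinates the same way and might move a single difference without bringing the solutions closer.
  But the differences sum to zero, so its pull must be paid for by mass passing between the positive
  and the negative differences, and that exchange is half the decay rate of \<open>\<Phi>\<close>.
  This is why the decay controls each variation. The displacement loading exceeds what the elastic
  ranges can absorb. Along \<open>u\<close> a shift remains free, so the hypothesis concerns the
  projection to \<open>V\<close>, and its reduced form holds for every shift \<open>z\<close>. The
  excess \<open>c0\<close> must appear as plastic flow.\<close>

section \<open>Absolutely continuous functions\<close>

text \<open>The definition sums over an initial segment of the naturals; the monotonicity proof
  below sums over cells of a tagged division and needs an arbitrary finite index set.\<close>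

lemma abs_cont_onD_finite:
  assumes "abs_cont_on a b f" "\<epsilon> > 0"
  obtains \<delta> where "\<delta> > 0"
    "\<And>I x y. finite I \<Longrightarrow> (\<And>i. i \<in> I \<Longrightarrow> a \<le> x i \<and> x i \<le> y i \<and> y i \<le> b) \<Longrightarrow>
       (\<And>i j. i \<in> I \<Longrightarrow> j \<in> I \<Longrightarrow> i \<noteq> j \<Longrightarrow> y i \<le> x j \<or> y j \<le> x i) \<Longrightarrow>
       (\<Sum>i\<in>I. y i - x i) < \<delta> \<Longrightarrow> (\<Sum>i\<in>I. norm (f (y i) - f (x i))) < \<epsilon>"
proof -
  obtain \<delta> where \<delta>: "\<delta> > 0" and *: "\<And>(N::nat) x y.
        (\<forall>k<N. a \<le> x k \<and> x k \<le> y k \<and> y k \<le> b) \<and>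
        (\<forall>k<N. \<forall>k'<N. k \<noteq> k' \<longrightarrow> y k \<le> x k' \<or> y k' \<le> x k) \<and>
        (\<Sum>k<N. y k - x k) < \<delta>
        \<longrightarrow> (\<Sum>k<N. norm (f (y k) - f (x k))) < \<epsilon>"
    using assms(1)[unfolded abs_cont_on_def, rule_format, OF assms(2)] by blast
  show thesis
  proof (rule that[OF \<delta>])
    fix I :: "'i set" and x y :: "'i \<Rightarrow> real"
    assume fin: "finite I" and in_ab: "\<And>i. i \<in> I \<Longrightarrow> a \<le> x i \<and> x i \<le> y i \<and> y i \<le> b"
      and disj: "\<And>i j. i \<in> I \<Longrightarrow> j \<in> I \<Longrightarrow> i \<noteq> j \<Longrightarrow> y i \<le> x j \<or> y j \<le> x i"
      and len: "(\<Sum>i\<in>I. y i - x i) < \<delta>"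
    obtain h where h: "bij_betw h {..<card I} I"
      using ex_bij_betw_nat_finite[OF fin] by (auto simp: atLeast0LessThan)
    have hI: "h k \<in> I" if "k < card I" for k
      using h that by (auto simp: bij_betw_def)
    have inj: "h k \<noteq> h k'" if "k < card I" "k' < card I" "k \<noteq> k'" for k k'
      using h that by (auto simp: bij_betw_def inj_on_def)
    have "(\<Sum>k<card I. y (h k) - x (h k)) < \<delta>"
      using len by (simp add: sum.reindex_bij_betw[OF h, where g="\<lambda>i. y i - x i"])
    then have "(\<Sum>k<card I. norm (f (y (h k)) - f (x (h k)))) < \<epsilon>"
      using *[of "card I" "\<lambda>k. x (h k)" "\<lambda>k. y (h k)"] hI in_ab disj inj by blast
    then show "(\<Sum>i\<in>I. norm (f (y i) - f (x i))) < \<epsilon>"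
      by (simp add: sum.reindex_bij_betw[OF h, where g="\<lambda>i. norm (f (y i) - f (x i))"])
  qed
qed

text \<open>Absolute continuity has to pass from plastic strains to functions whose increments are
  Lipschitz in them, such as coordinates and sums of absolute values. The sign of \<open>K\<close>
  is arbitrary, hence \<open>\<bar>K\<bar> + 1\<close> in the proof.\<close>

lemma abs_cont_on_dominated:
  assumes "abs_cont_on a b f"
    and dom: "\<And>x y. a \<le> x \<Longrightarrow> x \<le> y \<Longrightarrow> y \<le> b \<Longrightarrow> norm (g y - g x) \<le> K * norm (f y - f x)"
  shows "abs_cont_on a b g"
  unfolding abs_cont_on_def
proof (intro allI impI)
  fix \<epsilon> :: real assume "\<epsilon> > 0"
  define K' where "K' = \<bar>K\<bar> + 1"
  have K': "K' > 0" "K \<le> K'" unfolding K'_def by auto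
  then have "\<epsilon> / K' > 0" using \<open>\<epsilon> > 0\<close> by simp
  then obtain \<delta> where "\<delta> > 0" and *: "\<And>(N::nat) x y.
        (\<forall>k<N. a \<le> x k \<and> x k \<le> y k \<and> y k \<le> b) \<and>
        (\<forall>k<N. \<forall>k'<N. k \<noteq> k' \<longrightarrow> y k \<le> x k' \<or> y k' \<le> x k) \<and>
        (\<Sum>k<N. y k - x k) < \<delta>
        \<longrightarrow> (\<Sum>k<N. norm (f (y k) - f (x k))) < \<epsilon> / K'"
    using assms(1)[unfolded abs_cont_on_def, rule_format, OF \<open>\<epsilon> / K' > 0\<close>] by blast
  show "\<exists>\<delta>>0. \<forall>(N::nat) x y.
        (\<forall>k<N. a \<le> x k \<and> x k \<le> y k \<and> y k \<le> b) \<and>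
        (\<forall>k<N. \<forall>k'<N. k \<noteq> k' \<longrightarrow> y k \<le> x k' \<or> y k' \<le> x k) \<and>
        (\<Sum>k<N. y k - x k) < \<delta>
        \<longrightarrow> (\<Sum>k<N. norm (g (y k) - g (x k))) < \<epsilon>"
  proof (intro exI[of _ \<delta>] conjI \<open>\<delta> > 0\<close> allI impI)
    fix N :: nat and x y
    assume A: "(\<forall>k<N. a \<le> x k \<and> x k \<le> y k \<and> y k \<le> b) \<and>
        (\<forall>k<N. \<forall>k'<N. k \<noteq> k' \<longrightarrow> y k \<le> x k' \<or> y k' \<le> x k) \<and> (\<Sum>k<N. y k - x k) < \<delta>"
    have "norm (g (y k) - g (x k)) \<le> K' * norm (f (y k) - f (x k))" if "k < N" for k
      using dom[of "x k" "y k"] A that mult_right_mono[OF K'(2) norm_ge_zero, of "f (y k) - f (x k)"]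
      by force
    then have "(\<Sum>k<N. norm (g (y k) - g (x k))) \<le> K' * (\<Sum>k<N. norm (f (y k) - f (x k)))"
      unfolding sum_distrib_left by (intro sum_mono) auto
    also have "\<dots> < K' * (\<epsilon> / K')"
      using * A K' by (intro mult_strict_left_mono) auto
    finally show "(\<Sum>k<N. norm (g (y k) - g (x k))) < \<epsilon>"
      using K' by simp
  qed
qed

lemma abs_cont_on_diff:
  assumes "abs_cont_on a b f" "abs_cont_on a b g"
  shows "abs_cont_on a b (\<lambda>t. f t - g t)"
  unfolding abs_cont_on_def
proof (intro allI impI)
  fix \<epsilon> :: real assume "\<epsilon> > 0"
  then have e2: "\<epsilon>/2 > 0" by simp
  obtain \<delta>1 where \<delta>1: "\<delta>1 > 0" and 1: "\<And>I x y. finite (I::nat set) \<Longrightarrow> (\<And>i. i \<in> I \<Longrightarrow> a \<le> x i \<and> x i \<le> y i \<and> y i \<le> b) \<Longrightarrow>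
       (\<And>i j. i \<in> I \<Longrightarrow> j \<in> I \<Longrightarrow> i \<noteq> j \<Longrightarrow> y i \<le> x j \<or> y j \<le> x i) \<Longrightarrow>
       (\<Sum>i\<in>I. y i - x i) < \<delta>1 \<Longrightarrow> (\<Sum>i\<in>I. norm (f (y i) - f (x i))) < \<epsilon>/2"
    by (rule abs_cont_onD_finite[OF assms(1) e2]) blast
  obtain \<delta>2 where \<delta>2: "\<delta>2 > 0" and 2: "\<And>I x y. finite (I::nat set) \<Longrightarrow> (\<And>i. i \<in> I \<Longrightarrow> a \<le> x i \<and> x i \<le> y i \<and> y i \<le> b) \<Longrightarrow>
       (\<And>i j. i \<in> I \<Longrightarrow> j \<in> I \<Longrightarrow> i \<noteq> j \<Longrightarrow> y i \<le> x j \<or> y j \<le> x i) \<Longrightarrow>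
       (\<Sum>i\<in>I. y i - x i) < \<delta>2 \<Longrightarrow> (\<Sum>i\<in>I. norm (g (y i) - g (x i))) < \<epsilon>/2"
    by (rule abs_cont_onD_finite[OF assms(2) e2]) blast
  show "\<exists>\<delta>>0. \<forall>(N::nat) x y.
        (\<forall>k<N. a \<le> x k \<and> x k \<le> y k \<and> y k \<le> b) \<and>
        (\<forall>k<N. \<forall>k'<N. k \<noteq> k' \<longrightarrow> y k \<le> x k' \<or> y k' \<le> x k) \<and>
        (\<Sum>k<N. y k - x k) < \<delta>
        \<longrightarrow> (\<Sum>k<N. norm (f (y k) - g (y k) - (f (x k) - g (x k)))) < \<epsilon>"
  proof (intro exI[of _ "min \<delta>1 \<delta>2"] conjI allI impI)
    fix N :: nat and x y
    assume A: "(\<forall>k<N. a \<le> x k \<and> x k \<le> y k \<and> y k \<le> b) \<and>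
        (\<forall>k<N. \<forall>k'<N. k \<noteq> k' \<longrightarrow> y k \<le> x k' \<or> y k' \<le> x k) \<and> (\<Sum>k<N. y k - x k) < min \<delta>1 \<delta>2"
    have "norm (f (y k) - g (y k) - (f (x k) - g (x k)))
        \<le> norm (f (y k) - f (x k)) + norm (g (y k) - g (x k))" for k
      using norm_triangle_ineq4[of "f (y k) - f (x k)" "g (y k) - g (x k)"] by (simp add: algebra_simps)
    then have "(\<Sum>k<N. norm (f (y k) - g (y k) - (f (x k) - g (x k))))
        \<le> (\<Sum>k<N. norm (f (y k) - f (x k))) + (\<Sum>k<N. norm (g (y k) - g (x k)))"
      unfolding sum.distrib[symmetric] by (intro sum_mono)
    also have "\<dots> < \<epsilon>/2 + \<epsilon>/2"
      using A by (intro add_strict_mono 1 2) auto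
    finally show "(\<Sum>k<N. norm (f (y k) - g (y k) - (f (x k) - g (x k)))) < \<epsilon>" by simp
  qed (use \<delta>1 \<delta>2 in auto)
qed

lemma abs_cont_on_subinterval:
  assumes "abs_cont_on a b f" "a \<le> c" "d \<le> b"
  shows "abs_cont_on c d f"
  unfolding abs_cont_on_def
proof (intro allI impI)
  fix \<epsilon> :: real assume "\<epsilon> > 0"
  obtain \<delta> where "\<delta> > 0" and *: "\<And>(N::nat) x y.
        (\<forall>k<N. a \<le> x k \<and> x k \<le> y k \<and> y k \<le> b) \<and>
        (\<forall>k<N. \<forall>k'<N. k \<noteq> k' \<longrightarrow> y k \<le> x k' \<or> y k' \<le> x k) \<and>
        (\<Sum>k<N. y k - x k) < \<delta>
        \<longrightarrow> (\<Sum>k<N. norm (f (y k) - f (x k))) < \<epsilon>"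
    using assms(1)[unfolded abs_cont_on_def, rule_format, OF \<open>\<epsilon> > 0\<close>] by blast
  show "\<exists>\<delta>>0. \<forall>(N::nat) x y.
        (\<forall>k<N. c \<le> x k \<and> x k \<le> y k \<and> y k \<le> d) \<and>
        (\<forall>k<N. \<forall>k'<N. k \<noteq> k' \<longrightarrow> y k \<le> x k' \<or> y k' \<le> x k) \<and>
        (\<Sum>k<N. y k - x k) < \<delta>
        \<longrightarrow> (\<Sum>k<N. norm (f (y k) - f (x k))) < \<epsilon>"
  proof (intro exI[of _ \<delta>] conjI \<open>\<delta> > 0\<close> allI impI)
    fix N :: nat and x y
    assume "(\<forall>k<N. c \<le> x k \<and> x k \<le> y k \<and> y k \<le> d) \<and>
        (\<forall>k<N. \<forall>k'<N. k \<noteq> k' \<longrightarrow> y k \<le> x k' \<or> y k' \<le> x k) \<and> (\<Sum>k<N. y k - x k) < \<delta>"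
    then show "(\<Sum>k<N. norm (f (y k) - f (x k))) < \<epsilon>"
      using *[of N x y] assms(2,3) by force
  qed
qed

lemma abs_cont_on_shift:
  assumes "abs_cont_on (a + \<tau>) (b + \<tau>) f"
  shows "abs_cont_on a b (\<lambda>t. f (t + \<tau>))"
  unfolding abs_cont_on_def
proof (intro allI impI)
  fix \<epsilon> :: real assume "\<epsilon> > 0"
  obtain \<delta> where "\<delta> > 0" and *: "\<And>(N::nat) x y.
        (\<forall>k<N. a + \<tau> \<le> x k \<and> x k \<le> y k \<and> y k \<le> b + \<tau>) \<and>
        (\<forall>k<N. \<forall>k'<N. k \<noteq> k' \<longrightarrow> y k \<le> x k' \<or> y k' \<le> x k) \<and>
        (\<Sum>k<N. y k - x k) < \<delta>
        \<longrightarrow> (\<Sum>k<N. norm (f (y k) - f (x k))) < \<epsilon>"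
    using assms(1)[unfolded abs_cont_on_def, rule_format, OF \<open>\<epsilon> > 0\<close>] by blast
  show "\<exists>\<delta>>0. \<forall>(N::nat) x y.
        (\<forall>k<N. a \<le> x k \<and> x k \<le> y k \<and> y k \<le> b) \<and>
        (\<forall>k<N. \<forall>k'<N. k \<noteq> k' \<longrightarrow> y k \<le> x k' \<or> y k' \<le> x k) \<and>
        (\<Sum>k<N. y k - x k) < \<delta>
        \<longrightarrow> (\<Sum>k<N. norm (f (y k + \<tau>) - f (x k + \<tau>))) < \<epsilon>"
  proof (intro exI[of _ \<delta>] conjI \<open>\<delta> > 0\<close> allI impI)
    fix N :: nat and x y
    assume "(\<forall>k<N. a \<le> x k \<and> x k \<le> y k \<and> y k \<le> b) \<and>
        (\<forall>k<N. \<forall>k'<N. k \<noteq> k' \<longrightarrow> y k \<le> x k' \<or> y k' \<le> x k) \<and> (\<Sum>k<N. y k - x k) < \<delta>"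
    then show "(\<Sum>k<N. norm (f (y k + \<tau>) - f (x k + \<tau>))) < \<epsilon>"
      using *[of N "\<lambda>k. x k + \<tau>" "\<lambda>k. y k + \<tau>"] by simp
  qed
qed

lemma abs_cont_on_imp_continuous_on:
  assumes "abs_cont_on a b f"
  shows "continuous_on {a..b} f"
  unfolding continuous_on_iff
proof (intro ballI allI impI)
  fix x and \<epsilon> :: real assume x: "x \<in> {a..b}" and "\<epsilon> > 0"
  obtain \<delta> where \<delta>: "\<delta> > 0" and *: "\<And>I x y. finite (I::nat set) \<Longrightarrow> (\<And>i. i \<in> I \<Longrightarrow> a \<le> x i \<and> x i \<le> y i \<and> y i \<le> b) \<Longrightarrow>
       (\<And>i j. i \<in> I \<Longrightarrow> j \<in> I \<Longrightarrow> i \<noteq> j \<Longrightarrow> y i \<le> x j \<or> y j \<le> x i) \<Longrightarrow>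
       (\<Sum>i\<in>I. y i - x i) < \<delta> \<Longrightarrow> (\<Sum>i\<in>I. norm (f (y i) - f (x i))) < \<epsilon>"
    by (rule abs_cont_onD_finite[OF assms \<open>\<epsilon> > 0\<close>]) blast
  have "dist (f y) (f x) < \<epsilon>" if "y \<in> {a..b}" "dist y x < \<delta>" for y
    using *[of "{0}" "\<lambda>_. min x y" "\<lambda>_. max x y"] that x
    by (cases "x \<le> y") (auto simp: dist_norm min_def max_def norm_minus_commute)
  then show "\<exists>d>0. \<forall>x'\<in>{a..b}. dist x' x < d \<longrightarrow> dist (f x') (f x) < \<epsilon>"
    using \<delta> by blast
qed

text \<open>Cousin's lemma replaces Vitali's covering theorem here: the null set is handled by the gauge
  that witnesses that its indicator function has Henstock-Kurzweil integral zero.\<close>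

lemma abs_cont_on_AE_deriv_nonneg_imp_le:
  fixes F :: "real \<Rightarrow> real"
  assumes AC: "abs_cont_on a b F" and "a \<le> b" and N: "negligible N"
    and deriv: "\<And>x. x \<in> {a..b} - N \<Longrightarrow> \<exists>d\<ge>0. (F has_real_derivative d) (at x)"
  shows "F a \<le> F b"
proof (rule field_le_epsilon)
  fix \<epsilon>0 :: real assume "\<epsilon>0 > 0"
  \<comment> \<open>The cells with a tag outside \<open>N\<close> cost
    \<open>\<epsilon> * (b - a)\<close>, the others \<open>\<epsilon>\<close>; the summand 1 pays
    for the latter.\<close>
  define \<epsilon> where "\<epsilon> = \<epsilon>0 / (b - a + 1)"
  have "\<epsilon> * (b - a + 1) = \<epsilon>0" using \<open>a \<le> b\<close> by (simp add: \<epsilon>_def)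
  then have \<epsilon>: "\<epsilon> > 0" "\<epsilon> * (b - a) + \<epsilon> = \<epsilon>0"
    using \<open>\<epsilon>0 > 0\<close> \<open>a \<le> b\<close> by (simp add: \<epsilon>_def, simp add: distrib_left)
  obtain \<delta> where \<delta>: "\<delta> > 0" and small: "\<And>I x y. finite (I::(real \<times> real set) set) \<Longrightarrow>
       (\<And>i. i \<in> I \<Longrightarrow> a \<le> x i \<and> x i \<le> y i \<and> y i \<le> b) \<Longrightarrow>
       (\<And>i j. i \<in> I \<Longrightarrow> j \<in> I \<Longrightarrow> i \<noteq> j \<Longrightarrow> y i \<le> x j \<or> y j \<le> x i) \<Longrightarrow>
       (\<Sum>i\<in>I. y i - x i) < \<delta> \<Longrightarrow> (\<Sum>i\<in>I. norm (F (y i) - F (x i))) < \<epsilon>"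
    by (rule abs_cont_onD_finite[OF AC \<epsilon>(1)]) blast
  have "(indicator N has_integral (0::real)) {a..b}"
    using N unfolding negligible_def by (metis box_real(2))
  then obtain \<gamma>1 where g1: "gauge \<gamma>1" and null: "\<And>\<D>. \<D> tagged_division_of {a..b} \<Longrightarrow> \<gamma>1 fine \<D> \<Longrightarrow>
      norm ((\<Sum>(x,k)\<in>\<D>. measure lborel k *\<^sub>R indicator N x) - (0::real)) < \<delta>"
    using \<delta> unfolding has_integral_real by meson
  \<comment> \<open>Straddle estimate: each end of a cell is compared with the tag separately, so
    nothing is asked of the other points of the cell.\<close>
  have "\<exists>d>0. \<forall>y. \<bar>y - x\<bar> < d \<longrightarrow> F y - F x \<ge> - \<epsilon> * (y - x) \<and> y \<ge> x \<or> F x - F y \<ge> - \<epsilon> * (x - y) \<and> y \<le> x"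
    if x: "x \<in> {a..b} - N" for x
  proof -
    obtain D where D: "D \<ge> 0" "(F has_real_derivative D) (at x)" using deriv[OF x] by blast
    then obtain d where "d > 0" and d: "\<And>y. norm (y - x) < d \<Longrightarrow> norm (F y - F x - D * (y - x)) \<le> \<epsilon> * norm (y - x)"
      using \<epsilon>(1) unfolding has_field_derivative_def has_derivative_at_alt by blast
    have "F y - F x \<ge> - \<epsilon> * (y - x) \<and> y \<ge> x \<or> F x - F y \<ge> - \<epsilon> * (x - y) \<and> y \<le> x" if "\<bar>y - x\<bar> < d" for y
    proof (cases "y \<ge> x")
      case True
      then show ?thesis using d[of y] that mult_nonneg_nonneg[OF D(1), of "y - x"] by auto
    next
      case False
      then show ?thesis using d[of y] that mult_nonneg_nonneg[OF D(1), of "x - y"]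
        by (auto simp: algebra_simps)
    qed
    with \<open>d > 0\<close> show ?thesis by blast
  qed
  then obtain d where d: "\<And>x. x \<in> {a..b} - N \<Longrightarrow> d x > 0"
    "\<And>x y. x \<in> {a..b} - N \<Longrightarrow> \<bar>y - x\<bar> < d x \<Longrightarrow>
       F y - F x \<ge> - \<epsilon> * (y - x) \<and> y \<ge> x \<or> F x - F y \<ge> - \<epsilon> * (x - y) \<and> y \<le> x"
    by metis
  \<comment> \<open>The radius 1 is arbitrary: at a tag in \<open>N\<close> only
    \<open>\<gamma>1\<close> matters.\<close>
  define \<gamma>2 where "\<gamma>2 x = ball x (if x \<in> {a..b} - N then d x else 1)" for x
  have "gauge \<gamma>2" unfolding \<gamma>2_def using d(1) by (intro gauge_ball_dependent) auto
  then have "gauge (\<lambda>x. \<gamma>1 x \<inter> \<gamma>2 x)" using g1 by (intro gauge_Int)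
  then obtain \<D> where \<D>: "\<D> tagged_division_of {a..b}" and fine: "(\<lambda>x. \<gamma>1 x \<inter> \<gamma>2 x) fine \<D>"
    by (rule fine_division_exists_real)
  have fin: "finite \<D>" using \<D> by auto
  have f1: "\<gamma>1 fine \<D>" and f2: "\<gamma>2 fine \<D>" using fine by (auto simp: fine_Int)
  have interval: "\<exists>u v. K = {u..v} \<and> a \<le> u \<and> u \<le> x \<and> x \<le> v \<and> v \<le> b" if z: "(x, K) \<in> \<D>" for x K
  proof -
    obtain u v where K: "K = cbox u v" using tagged_division_ofD(4)[OF \<D> z] by blast
    moreover have "x \<in> K" "K \<subseteq> {a..b}" using tagged_division_ofD(2,3)[OF \<D> z] by auto
    ultimately show ?thesis by (intro exI[of _ u] exI[of _ v]) auto
  qed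
  \<comment> \<open>Cells of length zero are left out: having empty interior, they could lie inside
    another cell and violate the ordering demanded by absolute continuity. Their increments vanish
    anyway.\<close>
  define B where "B = {z \<in> \<D>. fst z \<in> N \<and> Inf (snd z) < Sup (snd z)}"
  have good: "F (Sup K) - F (Inf K) \<ge> - \<epsilon> * (Sup K - Inf K)"
    if z: "(x, K) \<in> \<D>" "(x, K) \<notin> B" for x K
  proof -
    obtain u v where K: "K = {u..v}" "a \<le> u" "u \<le> x" "x \<le> v" "v \<le> b" using interval[OF z(1)] by blast
    then have [simp]: "Sup K = v" "Inf K = u" by auto
    show ?thesis
    proof (cases "x \<in> N")
      case True
      then have "u = v" using z K by (auto simp: B_def)
      then show ?thesis by simp
    next
      case False
      then have x: "x \<in> {a..b} - N" using K by auto
      have "K \<subseteq> ball x (d x)" using fineD[OF f2 z(1)] x by (simp add: \<gamma>2_def)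
      then have "u \<in> ball x (d x)" "v \<in> ball x (d x)" by (rule subsetD, simp add: K(1), use K in simp)+
      then have "\<bar>u - x\<bar> < d x" "\<bar>v - x\<bar> < d x" by (auto simp: dist_real_def)
      then have "F v - F x \<ge> - \<epsilon> * (v - x)" "F x - F u \<ge> - \<epsilon> * (x - u)"
        using d(2)[OF x, of u] d(2)[OF x, of v] K by (cases "v = x"; cases "u = x"; force)+
      then show ?thesis by (simp add: algebra_simps)
    qed
  qed
  have "B \<subseteq> \<D>" by (auto simp: B_def)
  have finB: "finite B" using fin \<open>B \<subseteq> \<D>\<close> by (rule rev_finite_subset)
  have bad: "(\<Sum>z\<in>B. norm (F (Sup (snd z)) - F (Inf (snd z)))) < \<epsilon>"
  proof (rule small[OF finB])
    fix z assume "z \<in> B"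
    then have "(fst z, snd z) \<in> \<D>" using \<open>B \<subseteq> \<D>\<close> by auto
    then obtain u v where "snd z = {u..v}" "a \<le> u" "u \<le> fst z" "fst z \<le> v" "v \<le> b"
      using interval by blast
    then show "a \<le> Inf (snd z) \<and> Inf (snd z) \<le> Sup (snd z) \<and> Sup (snd z) \<le> b" by auto
  next
    fix z z' assume z: "z \<in> B" "z' \<in> B" "z \<noteq> z'"
    then have zD: "(fst z, snd z) \<in> \<D>" "(fst z', snd z') \<in> \<D>" using \<open>B \<subseteq> \<D>\<close> by auto
    obtain u v where K: "snd z = {u..v}" "u \<le> v"
      using interval[OF zD(1)] by (meson order_trans)
    obtain u' v' where K': "snd z' = {u'..v'}" "u' \<le> v'"
      using interval[OF zD(2)] by (meson order_trans)
    have lt: "u < v" "u' < v'" using z K K' by (auto simp: B_def)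
    have "interior (snd z) \<inter> interior (snd z') = {}"
      using tagged_division_ofD(5)[OF \<D> zD] z(3) by (metis prod.collapse)
    then have "{u<..<v} \<inter> {u'<..<v'} = {}" using K K' by (simp add: interior_atLeastAtMost_real)
    then have "v \<le> u' \<or> v' \<le> u"
      using lt dense[of "max u u'" "min v v'"] by (force simp: disjoint_iff not_le)
    then show "Sup (snd z) \<le> Inf (snd z') \<or> Sup (snd z') \<le> Inf (snd z)" using K K' by simp
  next
    have "(\<Sum>z\<in>B. Sup (snd z) - Inf (snd z)) \<le> (\<Sum>(x,k)\<in>\<D>. measure lborel k *\<^sub>R indicator N x)"
    proof -
      have "(\<Sum>z\<in>B. Sup (snd z) - Inf (snd z)) = (\<Sum>(x,k)\<in>B. measure lborel k *\<^sub>R indicator N x)"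
      proof (rule sum.cong[OF refl], clarify)
        fix x K assume z: "(x, K) \<in> B"
        then have "(x, K) \<in> \<D>" using \<open>B \<subseteq> \<D>\<close> by auto
        then obtain u v where "K = {u..v}" "a \<le> u" "u \<le> x" "x \<le> v" "v \<le> b" using interval by blast
        then show "Sup (snd (x, K)) - Inf (snd (x, K)) = measure lborel K *\<^sub>R indicator N x"
          using z by (auto simp: B_def)
      qed
      also have "\<dots> \<le> (\<Sum>(x,k)\<in>\<D>. measure lborel k *\<^sub>R indicator N x)"
        by (rule sum_mono2[OF fin \<open>B \<subseteq> \<D>\<close>]) (auto simp: indicator_def)
      finally show ?thesis .
    qed
    also have "\<dots> < \<delta>" using null[OF \<D> f1] by simp
    finally show "(\<Sum>z\<in>B. Sup (snd z) - Inf (snd z)) < \<delta>" .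
  qed
  have "F b - F a = (\<Sum>z\<in>\<D>. F (Sup (snd z)) - F (Inf (snd z)))"
    using additive_tagged_division_1[OF \<open>a \<le> b\<close> \<D>, of F] by (simp add: case_prod_beta)
  also have "\<dots> = (\<Sum>z\<in>\<D> - B. F (Sup (snd z)) - F (Inf (snd z))) + (\<Sum>z\<in>B. F (Sup (snd z)) - F (Inf (snd z)))"
    using sum.subset_diff[OF \<open>B \<subseteq> \<D>\<close> fin] .
  also have "\<dots> \<ge> (\<Sum>z\<in>\<D> - B. - \<epsilon> * (Sup (snd z) - Inf (snd z))) - \<epsilon>"
  proof -
    have 1: "(\<Sum>z\<in>\<D> - B. - \<epsilon> * (Sup (snd z) - Inf (snd z))) \<le> (\<Sum>z\<in>\<D> - B. F (Sup (snd z)) - F (Inf (snd z)))"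
      using good by (intro sum_mono) force
    have 2: "\<bar>\<Sum>z\<in>B. F (Sup (snd z)) - F (Inf (snd z))\<bar> \<le> \<epsilon>"
      using bad sum_abs[of "\<lambda>z. F (Sup (snd z)) - F (Inf (snd z))" B] unfolding real_norm_def by linarith
    show ?thesis using 1 2 by linarith
  qed
  moreover have "(\<Sum>z\<in>\<D> - B. - \<epsilon> * (Sup (snd z) - Inf (snd z))) \<ge> - \<epsilon> * (b - a)"
  proof -
    have "(\<Sum>z\<in>\<D> - B. Sup (snd z) - Inf (snd z)) \<le> (\<Sum>z\<in>\<D>. Sup (snd z) - Inf (snd z))"
    proof (rule sum_mono2[OF fin])
      fix z assume "z \<in> \<D> - (\<D> - B)"
      then show "0 \<le> Sup (snd z) - Inf (snd z)" by (auto simp: B_def)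
    qed auto
    also have "\<dots> = b - a"
      using additive_tagged_division_1[OF \<open>a \<le> b\<close> \<D>, of "\<lambda>x. x"] by (simp add: case_prod_beta)
    finally have "(\<Sum>z\<in>\<D> - B. Sup (snd z) - Inf (snd z)) \<le> b - a" .
    from mult_left_mono_neg[OF this, of "- \<epsilon>"] show ?thesis
      using \<epsilon>(1) by (simp add: sum_distrib_left)
  qed
  ultimately show "F a \<le> F b + \<epsilon>0" using \<epsilon>(2) by simp
qed

text \<open>A zero with nonzero derivative is isolated among the zeros, and a set of isolated points
  is countable in a second countable space. So, off a null set, a differentiable zero has derivative
  zero, which is what differentiating an absolute value requires.\<close>

lemma countable_transversal_zeros:
  fixes f :: "real \<Rightarrow> real"
  shows "countable {t. f t = 0 \<and> (\<exists>d. d \<noteq> 0 \<and> (f has_real_derivative d) (at t))}" (is "countable ?S")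
proof -
  define S where "S = ?S"
  obtain \<B> :: "real set set" where \<B>: "countable \<B>" "topological_basis \<B>"
    using ex_countable_basis by blast
  have "\<exists>X\<in>\<B>. X \<inter> S = {t}" if t: "t \<in> S" for t
  proof -
    obtain d where d: "d \<noteq> 0" "(f has_real_derivative d) (at t)" and ft: "f t = 0" using t by (auto simp: S_def)
    have "((\<lambda>y. (f y - f t) / (y - t)) \<longlongrightarrow> d) (at t)"
      using d(2) by (simp add: has_field_derivative_iff)
    then have "eventually (\<lambda>y. (f y - f t) / (y - t) \<noteq> 0) (at t)"
      using d(1) by (rule tendsto_imp_eventually_ne)
    then obtain Y where Y: "open Y" "t \<in> Y" "\<And>y. y \<in> Y \<Longrightarrow> y \<noteq> t \<Longrightarrow> (f y - f t) / (y - t) \<noteq> 0"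
      unfolding eventually_at_topological by blast
    obtain X where X: "X \<in> \<B>" "t \<in> X" "X \<subseteq> Y"
      using \<B>(2) Y(1,2) by (rule topological_basisE)
    have "X \<inter> S = {t}" using X(2,3) Y(3) ft t by (auto simp: S_def)
    then show ?thesis using X(1) by blast
  qed
  then have "\<forall>t\<in>S. \<exists>X. X \<in> \<B> \<and> X \<inter> S = {t}" by blast
  from bchoice[OF this] obtain X where X: "\<forall>t\<in>S. X t \<in> \<B> \<and> X t \<inter> S = {t}" by blast
  have "inj_on X S"
  proof (rule inj_onI)
    fix t t' assume *: "t \<in> S" "t' \<in> S" "X t = X t'"
    have "t \<in> X t \<inter> S" using X *(1) by blast
    also have "\<dots> = X t' \<inter> S" using *(3) by simp
    also have "\<dots> = {t'}" using X *(2) by blast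
    finally show "t = t'" by simp
  qed
  moreover have "countable (X ` S)" by (rule countable_subset[OF _ \<B>(1)]) (use X in blast)
  ultimately have "countable S" by (metis countable_image_inj_on)
  then show ?thesis by (simp add: S_def)
qed

section \<open>From almost every time to every time\<close>

lemma AE_lebesgue_negligibleE:
  fixes Q :: "'a::euclidean_space \<Rightarrow> bool"
  assumes "AE t in lebesgue. P t \<longrightarrow> Q t"
  obtains N where "negligible N" "\<And>t. P t \<Longrightarrow> t \<notin> N \<Longrightarrow> Q t"
proof -
  obtain N where "{t \<in> space lebesgue. \<not> (P t \<longrightarrow> Q t)} \<subseteq> N" "N \<in> null_sets lebesgue"
    using assms unfolding eventually_ae_filter by blast
  then show thesis by (intro that[of N]) (auto simp: negligible_iff_null_sets)
qed

text \<open>A negative value persists on an interval, which is not a null set. This extends the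
  almost-everywhere relations of the variational system to all times.\<close>

lemma AE_nonneg_imp_nonneg:
  fixes f :: "real \<Rightarrow> real"
  assumes cont: "continuous_on {0..} f" and N: "negligible N"
    and nonneg: "\<And>t. t \<ge> 0 \<Longrightarrow> t \<notin> N \<Longrightarrow> f t \<ge> 0" and "t \<ge> 0"
  shows "f t \<ge> 0"
proof (rule ccontr)
  assume "\<not> f t \<ge> 0"
  then have neg: "- f t > 0" by simp
  then obtain d where "d > 0" and d: "\<And>y. y \<in> {0..} \<Longrightarrow> dist y t < d \<Longrightarrow> dist (f y) (f t) < - f t"
    using cont \<open>t \<ge> 0\<close> unfolding continuous_on_iff by (metis atLeast_iff)
  \<comment> \<open>Only times to the right of \<open>t\<close> are used: they stay in the half-line
    even if \<open>t = 0\<close>.\<close>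
  have "f y < 0" if "y \<in> {t<..<t + d}" for y
    using d[of y] that \<open>t \<ge> 0\<close> by (auto simp: dist_real_def)
  then have "{t<..<t + d} \<subseteq> N" using nonneg \<open>t \<ge> 0\<close> by (intro subsetI) (metis greaterThanLessThan_iff not_less order.trans less_le)
  then have "negligible {t<..<t + d}" using N negligible_subset by blast
  then show False using \<open>d > 0\<close> open_not_negligible[of "{t<..<t + d}"] by simp
qed

lemma AE_zero_imp_zero:
  fixes f :: "real \<Rightarrow> real"
  assumes "continuous_on {0..} f" "negligible N"
    and "\<And>t. t \<ge> 0 \<Longrightarrow> t \<notin> N \<Longrightarrow> f t = 0" and "t \<ge> 0"
  shows "f t = 0"
  using AE_nonneg_imp_nonneg[of f N t] AE_nonneg_imp_nonneg[of "\<lambda>t. - f t" N t] assms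
  by (force intro: continuous_on_minus)

lemma abs_cont_on_all_imp_continuous_on:
  assumes "\<And>b. b \<ge> 0 \<Longrightarrow> abs_cont_on 0 b f"
  shows "continuous_on {0..} f"
  unfolding continuous_on_iff
proof (intro ballI allI impI)
  fix x \<epsilon> :: real assume x: "x \<in> {0..}" and "\<epsilon> > 0"
  have "continuous_on {0..x + 1} f"
    using x by (intro abs_cont_on_imp_continuous_on assms) simp
  then obtain d where "d > 0" and d: "\<And>y. y \<in> {0..x + 1} \<Longrightarrow> dist y x < d \<Longrightarrow> dist (f y) (f x) < \<epsilon>"
    using x \<open>\<epsilon> > 0\<close> unfolding continuous_on_iff by (metis atLeastAtMost_iff atLeast_iff le_add_same_cancel1 zero_le_one)
  show "\<exists>d>0. \<forall>y\<in>{0..}. dist y x < d \<longrightarrow> dist (f y) (f x) < \<epsilon>"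
    using \<open>d > 0\<close> d by (intro exI[of _ "min d 1"]) (auto simp: dist_real_def)
qed

section \<open>Periodic attractors\<close>

text \<open>Comparing a member with its own translates makes the values at \<open>t + k T\<close> a
  Cauchy sequence in \<open>k\<close>; the uniform merging time carries the estimate to all members.
  The limit need not belong to \<open>S\<close>. It exists for negative \<open>t\<close> as well,
  since only the tail of the sequence matters.\<close>

lemma ex_periodic_attractor:
  fixes S :: "(real \<Rightarrow> 'a::banach) set"
  assumes "T > 0" and shift: "\<And>f. f \<in> S \<Longrightarrow> (\<lambda>t. f (t + T)) \<in> S"
    and merge: "\<And>\<epsilon>. \<epsilon> > 0 \<Longrightarrow> \<exists>\<tau>. \<forall>f\<in>S. \<forall>g\<in>S. \<forall>t\<ge>\<tau>. norm (f t - g t) \<le> \<epsilon>"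
  shows "\<exists>f0. (\<forall>t. f0 (t + T) = f0 t) \<and> (\<forall>f\<in>S. ((\<lambda>t. norm (f t - f0 t)) \<longlongrightarrow> 0) at_top)"
proof (cases "S = {}")
  case True
  then show ?thesis by (intro exI[of _ "\<lambda>_. 0"]) simp
next
  case False
  then obtain f where f: "f \<in> S" by blast
  have fk: "(\<lambda>t. f (t + real k * T)) \<in> S" for k
  proof (induction k)
    case (Suc k)
    have "(\<lambda>t. f (t + real (Suc k) * T)) = (\<lambda>t. f (t + T + real k * T))"
      by (simp add: algebra_simps)
    then show ?case using shift[OF Suc] by simp
  qed (use f in simp)
  have "Cauchy (\<lambda>k. f (t + real k * T))" for t
  proof (rule CauchyI')
    fix \<epsilon> :: real assume "\<epsilon> > 0"
    then obtain \<tau> where \<tau>: "\<forall>f\<in>S. \<forall>g\<in>S. \<forall>t\<ge>\<tau>. norm (f t - g t) \<le> \<epsilon> / 2"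
      using merge[of "\<epsilon> / 2"] by auto
    obtain M :: nat where M: "\<tau> - t < real M * T" using ex_less_of_nat_mult[OF \<open>T > 0\<close>] by blast
    have "dist (f (t + real l * T)) (f (t + real k * T)) < \<epsilon>" if lk: "M \<le> l" "l < k" for l k
    proof -
      have "real M * T \<le> real l * T" using lk \<open>T > 0\<close> by simp
      then have "t + real l * T \<ge> \<tau>" using M by simp
      then have "norm (f (t + real l * T) - f (t + real l * T + real (k - l) * T)) \<le> \<epsilon> / 2"
        using \<tau>[rule_format, OF f fk[of "k - l"]] by simp
      moreover have "t + real l * T + real (k - l) * T = t + real k * T"
        using lk by (simp add: of_nat_diff algebra_simps)
      ultimately show ?thesis using \<open>\<epsilon> > 0\<close> by (simp add: dist_norm)
    qed
    then show "\<exists>M. \<forall>m\<ge>M. \<forall>n>m. dist (f (t + real m * T)) (f (t + real n * T)) < \<epsilon>" by blast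
  qed
  then have lim: "(\<lambda>k. f (t + real k * T)) \<longlonglongrightarrow> lim (\<lambda>k. f (t + real k * T))" for t
    using Cauchy_convergent convergent_LIMSEQ_iff by blast
  define f0 where "f0 t = lim (\<lambda>k. f (t + real k * T))" for t
  have "f0 (t + T) = f0 t" for t
  proof -
    have "(\<lambda>k. f (t + T + real k * T)) = (\<lambda>k. f (t + real (Suc k) * T))"
      by (simp add: algebra_simps)
    then have "(\<lambda>k. f (t + T + real k * T)) \<longlonglongrightarrow> f0 t"
      using LIMSEQ_Suc[OF lim[of t]] by (simp add: f0_def)
    then show ?thesis using lim[of "t + T"] LIMSEQ_unique unfolding f0_def by blast
  qed
  moreover have "((\<lambda>t. norm (g t - f0 t)) \<longlongrightarrow> 0) at_top" if g: "g \<in> S" for g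
  proof (rule tendstoI)
    fix \<epsilon> :: real assume "\<epsilon> > 0"
    then obtain \<tau> where \<tau>: "\<forall>f\<in>S. \<forall>g\<in>S. \<forall>t\<ge>\<tau>. norm (f t - g t) \<le> \<epsilon> / 2"
      using merge[of "\<epsilon> / 2"] by auto
    have "norm (g t - f0 t) \<le> \<epsilon> / 2" if "t \<ge> \<tau>" for t
    proof (rule tendsto_upperbound)
      show "(\<lambda>k. norm (g t - f (t + real k * T))) \<longlonglongrightarrow> norm (g t - f0 t)"
        unfolding f0_def by (intro tendsto_norm tendsto_diff tendsto_const lim)
      show "\<forall>\<^sub>F k in sequentially. norm (g t - f (t + real k * T)) \<le> \<epsilon> / 2"
        using \<tau>[rule_format, OF g fk that] by (intro always_eventually) simp
    qed simp
    then have "\<forall>t\<ge>\<tau>. dist (norm (g t - f0 t)) 0 < \<epsilon>" using \<open>\<epsilon> > 0\<close> by force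
    then show "\<forall>\<^sub>F t in at_top. dist (norm (g t - f0 t)) 0 < \<epsilon>"
      unfolding eventually_at_top_linorder by blast
  qed
  ultimately show ?thesis by blast
qed

section \<open>Sweeping by a moving simplex\<close>

text \<open>At a zero the difference quotients of \<open>f\<close> tend to 0, hence so do those of
  its absolute value; elsewhere the sign is locally constant. One formula serves both cases because
  \<open>sgn 0 = 0\<close>.\<close>

lemma has_real_derivative_abs:
  fixes f :: "real \<Rightarrow> real"
  assumes f: "(f has_real_derivative d) (at t)" and zero: "f t = 0 \<Longrightarrow> d = 0"
  shows "((\<lambda>x. \<bar>f x\<bar>) has_real_derivative sgn (f t) * d) (at t)"
proof (cases "f t = 0")
  case True
  then have "((\<lambda>y. (f y - f t) / (y - t)) \<longlongrightarrow> 0) (at t)"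
    using f zero by (simp add: has_field_derivative_iff)
  then have "((\<lambda>y. \<bar>(f y - f t) / (y - t)\<bar>) \<longlongrightarrow> 0) (at t)"
    by (rule tendsto_rabs_zero)
  then have "((\<lambda>y. (\<bar>f y\<bar> - \<bar>f t\<bar>) / (y - t)) \<longlongrightarrow> 0) (at t)"
    by (rule Lim_null_comparison[rotated]) (simp add: True)
  then show ?thesis using True by (simp add: has_field_derivative_iff)
next
  case False
  have "isCont f t" using f by (rule DERIV_isCont)
  then have "((\<lambda>x. sgn (f t) * f x) \<longlongrightarrow> sgn (f t) * f t) (at t)"
    by (intro tendsto_mult tendsto_const) (simp add: isCont_def)
  moreover have pos: "sgn (f t) * f t > 0" using False by (simp add: sgn_if)
  ultimately have "\<forall>\<^sub>F x in at t. sgn (f t) * f x > 0" by (rule order_tendstoD(1))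
  then have "\<forall>\<^sub>F x in nhds t. sgn (f t) * f x > 0"
    using pos by (auto simp: eventually_nhds_conv_at)
  then have ev: "\<forall>\<^sub>F x in nhds t. \<bar>f x\<bar> = sgn (f t) * f x"
    by eventually_elim (auto simp: sgn_if split: if_splits)
  have "((\<lambda>x. sgn (f t) * f x) has_real_derivative sgn (f t) * d) (at t)"
    using f by (rule DERIV_cmult)
  then show ?thesis using DERIV_cong_ev[OF refl ev refl] by blast
qed

text \<open>In the application \<open>x\<close> is the difference of two solutions, \<open>d\<close>
  its rate and \<open>\<nu>\<close> the rate of the difference of the multipliers. Mass leaves one
  sign class of \<open>x\<close> as fast as it enters the other; this exchange rate bounds
  \<open>\<nu>\<close> and then each single rate.\<close>

lemma abs_rate_le_sgn_rate:
  fixes \<beta> x d :: "'m::finite \<Rightarrow> real"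
  assumes \<beta>: "\<And>j. \<beta> j > 0" and x: "sum x UNIV = 0" and d: "sum d UNIV = 0"
    and zero: "\<And>j. x j = 0 \<Longrightarrow> d j = 0"
    and pos: "\<And>j. x j > 0 \<Longrightarrow> d j \<le> - \<beta> j * \<nu>" and neg: "\<And>j. x j < 0 \<Longrightarrow> d j \<ge> - \<beta> j * \<nu>"
  shows "\<bar>d j\<bar> \<le> - (1 + sum \<beta> UNIV * (\<Sum>i\<in>UNIV. 1 / \<beta> i)) * (\<Sum>i\<in>UNIV. sgn (x i) * d i)"
proof -
  define K where "K = 1 + sum \<beta> UNIV * (\<Sum>i\<in>UNIV. 1 / \<beta> i)"
  have B: "sum \<beta> UNIV \<ge> 0" and C: "(\<Sum>i\<in>UNIV. 1 / \<beta> i) \<ge> 0"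
    using \<beta> by (simp_all add: sum_nonneg less_imp_le)
  then have K: "K \<ge> 1" unfolding K_def by simp
  have main: "\<bar>d j\<bar> \<le> - K * (\<Sum>i\<in>UNIV. sgn (x i) * d i)"
    if x: "sum x UNIV = 0" and d: "sum d UNIV = 0" and zero: "\<And>j. x j = 0 \<Longrightarrow> d j = 0"
      and pos: "\<And>j. x j > 0 \<Longrightarrow> d j \<le> - \<beta> j * \<nu>" and neg: "\<And>j. x j < 0 \<Longrightarrow> d j \<ge> - \<beta> j * \<nu>"
      and \<nu>: "\<nu> \<ge> 0" for x d :: "'m \<Rightarrow> real" and \<nu>
  proof -
    define X where "X = {i. x i > 0}"
    define Y where "Y = {i. x i < 0}"
    \<comment> \<open>The exchange rate: \<open>d\<close> has sum zero and vanishes off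
      \<open>X\<close> and \<open>Y\<close>, so the loss of \<open>X\<close> is the gain of
      \<open>Y\<close>.\<close>
    define s where "s = - sum d X"
    have disj: "X \<inter> Y = {}" by (auto simp: X_def Y_def)
    have "sum d (X \<union> Y) = sum d UNIV"
      by (rule sum.mono_neutral_left) (auto simp: X_def Y_def intro!: zero)
    then have Y: "sum d Y = s" using d sum.union_disjoint[OF _ _ disj, of d] by (simp add: s_def)
    have "(\<Sum>i\<in>UNIV. sgn (x i) * d i) = (\<Sum>i\<in>X \<union> Y. sgn (x i) * d i)"
      by (rule sum.mono_neutral_right) (auto simp: X_def Y_def intro!: zero)
    also have "\<dots> = (\<Sum>i\<in>X. sgn (x i) * d i) + (\<Sum>i\<in>Y. sgn (x i) * d i)"
      by (rule sum.union_disjoint) (use disj in auto)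
    also have "(\<Sum>i\<in>X. sgn (x i) * d i) = - s" by (simp add: s_def X_def)
    also have "(\<Sum>i\<in>Y. sgn (x i) * d i) = - s" by (simp add: Y[symmetric] Y_def sum_negf)
    finally have S: "(\<Sum>i\<in>UNIV. sgn (x i) * d i) = - 2 * s" by simp
    have dX: "d i \<le> 0" if "i \<in> X" for i
      using pos[of i] that mult_nonneg_nonneg[OF less_imp_le[OF \<beta>] \<nu>, of i] by (simp add: X_def)
    have dX_le: "- d i \<le> s" if "i \<in> X" for i
    proof -
      have "(\<lambda>i. - d i) i \<le> (\<Sum>i\<in>X. - d i)" by (rule member_le_sum) (use that dX in auto)
      then show ?thesis by (simp add: s_def sum_negf)
    qed
    have s0: "s \<ge> 0" using dX by (simp add: s_def sum_nonpos)
    \<comment> \<open>A nonzero \<open>x\<close> with sum zero has a positive entry; there the pull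
      \<open>\<beta> i * \<nu>\<close> is part of the loss \<open>s\<close>.\<close>
    have \<nu>_le: "\<nu> \<le> s * (\<Sum>i\<in>UNIV. 1 / \<beta> i)" if "x i0 \<noteq> 0" for i0
    proof -
      obtain i where i: "x i > 0"
      proof (rule ccontr)
        assume "\<not> thesis"
        then have "x i \<le> 0" for i using that by (meson not_le)
        then have "\<And>i. x i = 0" using x sum_nonneg_eq_0_iff[of UNIV "\<lambda>i. - x i"] by (simp add: sum_negf)
        then show False using \<open>x i0 \<noteq> 0\<close> by simp
      qed
      have "\<beta> i * \<nu> \<le> s" using pos[OF i] dX_le[of i] i by (simp add: X_def)
      then have "\<nu> \<le> s * (1 / \<beta> i)" using \<beta>[of i] by (simp add: field_simps)
      also have "\<dots> \<le> s * (\<Sum>i\<in>UNIV. 1 / \<beta> i)"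
        using s0 \<beta> by (intro mult_left_mono member_le_sum) (auto simp: less_imp_le)
      finally show ?thesis .
    qed
    have "\<bar>d j\<bar> \<le> s * K"
    proof (cases "x j" "0::real" rule: linorder_cases)
      case equal
      then show ?thesis using zero s0 K by simp
    next
      case greater
      then have "\<bar>d j\<bar> \<le> s" using dX[of j] dX_le[of j] by (simp add: X_def)
      also have "\<dots> \<le> s * K" using s0 K by (simp add: mult_le_cancel_left1)
      finally show ?thesis .
    next
      case less
      then have jY: "j \<in> Y" by (simp add: Y_def)
      have "sum \<beta> UNIV * \<nu> \<le> sum \<beta> UNIV * (s * (\<Sum>i\<in>UNIV. 1 / \<beta> i))"
        using less B by (intro mult_left_mono \<nu>_le[of j]) auto
      then have bound: "s + sum \<beta> UNIV * \<nu> \<le> s * K" by (simp add: K_def algebra_simps)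
      have "\<beta> j * \<nu> \<le> sum \<beta> UNIV * \<nu>"
        using \<beta> \<nu> by (intro mult_right_mono member_le_sum) (auto simp: less_imp_le)
      then have lower: "- d j \<le> s + sum \<beta> UNIV * \<nu>" using neg[OF less] s0 by simp
      \<comment> \<open>A gain of \<open>j\<close> above \<open>s\<close> has to be offset by losses
        in the rest of \<open>Y\<close>, and each of these is at most
        \<open>\<beta> i * \<nu>\<close>.\<close>
      have "s = d j + sum d (Y - {j})" using jY Y by (simp add: sum.remove)
      moreover have "- (sum \<beta> UNIV * \<nu>) \<le> sum d (Y - {j})"
      proof -
        have "sum \<beta> (Y - {j}) * \<nu> \<le> sum \<beta> UNIV * \<nu>"
          using \<beta> \<nu> by (intro mult_right_mono sum_mono2) (auto simp: less_imp_le)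
        moreover have "(\<Sum>i\<in>Y - {j}. - \<beta> i * \<nu>) \<le> sum d (Y - {j})"
          by (rule sum_mono) (use neg in \<open>auto simp: Y_def\<close>)
        ultimately show ?thesis by (simp add: sum_distrib_right sum_negf)
      qed
      ultimately have "d j \<le> s + sum \<beta> UNIV * \<nu>" by simp
      then show ?thesis using lower bound by linarith
    qed
    also have "\<dots> \<le> 2 * s * K" using s0 K by simp
    finally show ?thesis using S by (simp add: mult.commute)
  qed
  show ?thesis
  proof (cases "\<nu> \<ge> 0")
    case True
    then show ?thesis using main[OF x d zero pos neg] by (simp add: K_def)
  next
    case False
    \<comment> \<open>Exchanging the two solutions reverses the sign of \<open>\<nu>\<close> and
      preserves the sum of \<open>sgn (x i) * d i\<close>.\<close>
    have "\<bar>- d j\<bar> \<le> - K * (\<Sum>i\<in>UNIV. sgn (- x i) * - d i)"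
      by (rule main[of "\<lambda>i. - x i" "\<lambda>i. - d i" "- \<nu>"])
        (use False x d zero pos neg in \<open>force simp: sum_negf\<close>)+
    then show ?thesis by (simp add: K_def sgn_minus)
  qed
qed

text \<open>The coordinates \<open>\<sigma> $ j\<close> are the (scaled) distances of the stresses to the vertex of the box that
  the stress loading singles out; they range over the simplex of size \<open>\<rho> t\<close>.  The size never
  exceeds the widths \<open>W j\<close>, hence an upper elastic limit can only be active at a vertex of the simplex.
  The multiplier \<open>m\<close> accounts for the constraint that the coordinates sum to \<open>\<rho> t\<close>.\<close>

locale simplex_sweeping =
  fixes \<beta> W :: "'m::finite \<Rightarrow> real" and \<gamma> :: "real \<Rightarrow> 'm \<Rightarrow> real" and \<rho> :: "real \<Rightarrow> real"
    and T t1 t2 c0 \<Gamma> :: real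
  assumes \<beta>_pos: "\<And>j. 0 < \<beta> j"
    and \<rho>_le: "\<And>t j. 0 \<le> t \<Longrightarrow> \<rho> t \<le> W j"
    and \<gamma>_bounded: "\<And>t j. 0 \<le> t \<Longrightarrow> \<bar>\<gamma> t j\<bar> \<le> \<Gamma>"
    and T_pos: "0 < T"
    and \<gamma>_periodic: "\<And>t j. 0 \<le> t \<Longrightarrow> \<gamma> (t + T) j = \<gamma> t j"
    and \<rho>_periodic: "\<And>t. 0 \<le> t \<Longrightarrow> \<rho> (t + T) = \<rho> t"
    and t12: "0 \<le> t1" "t1 < t2" and c0: "0 < c0"
    and large: "\<And>z. c0 + L2_set (\<lambda>j. W j / sqrt (\<beta> j)) UNIV
        \<le> L2_set (\<lambda>j. sqrt (\<beta> j) * (\<gamma> t2 j - \<gamma> t1 j + z)) UNIV"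
begin

text \<open>In the application \<open>P\<close> is the plastic strain divided entrywise by
  \<open>u\<close>. The multiplier \<open>m\<close> carries no regularity: the prescribed sum
  determines it. The conditions on \<open>\<pi>\<close> are the flow rule: a positive rate requires
  contact with the facet, a negative one the vertex at which the opposite elastic limit is
  active.\<close>

definition solution :: "(real \<Rightarrow> real^'m) \<Rightarrow> (real \<Rightarrow> real^'m) \<Rightarrow> bool" where
  "solution \<sigma> P \<longleftrightarrow>
     (\<forall>b\<ge>0. abs_cont_on 0 b P) \<and>
     (\<exists>m. \<forall>t\<ge>0. \<forall>j. \<sigma> t $ j = \<beta> j * (P t $ j - \<gamma> t j - m t)) \<and>
     (\<forall>t\<ge>0. (\<forall>j. 0 \<le> \<sigma> t $ j) \<and> (\<Sum>j\<in>UNIV. \<sigma> t $ j) = \<rho> t) \<and>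
     (\<exists>N. negligible N \<and> (\<forall>t\<ge>0. t \<notin> N \<longrightarrow> (\<exists>\<pi>. (P has_vector_derivative \<pi>) (at t) \<and>
        (\<forall>j. (\<pi> $ j > 0 \<longrightarrow> \<sigma> t $ j = 0) \<and> (\<pi> $ j < 0 \<longrightarrow> (\<forall>i. i \<noteq> j \<longrightarrow> \<sigma> t $ i = 0))))))"

lemma solutionE:
  assumes "solution \<sigma> P"
  obtains m N where "\<And>b. b \<ge> 0 \<Longrightarrow> abs_cont_on 0 b P"
    "\<And>t j. t \<ge> 0 \<Longrightarrow> \<sigma> t $ j = \<beta> j * (P t $ j - \<gamma> t j - m t)"
    "\<And>t j. t \<ge> 0 \<Longrightarrow> 0 \<le> \<sigma> t $ j" "\<And>t. t \<ge> 0 \<Longrightarrow> (\<Sum>j\<in>UNIV. \<sigma> t $ j) = \<rho> t"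
    "negligible N" "\<And>t. t \<ge> 0 \<Longrightarrow> t \<notin> N \<Longrightarrow> \<exists>\<pi>. (P has_vector_derivative \<pi>) (at t) \<and>
        (\<forall>j. (\<pi> $ j > 0 \<longrightarrow> \<sigma> t $ j = 0) \<and> (\<pi> $ j < 0 \<longrightarrow> (\<forall>i. i \<noteq> j \<longrightarrow> \<sigma> t $ i = 0)))"
proof -
  note sol = assms[unfolded solution_def]
  obtain m where m: "\<forall>t\<ge>0. \<forall>j. \<sigma> t $ j = \<beta> j * (P t $ j - \<gamma> t j - m t)"
    using sol[THEN conjunct2, THEN conjunct1] by (rule exE)
  obtain N where N: "negligible N \<and> (\<forall>t\<ge>0. t \<notin> N \<longrightarrow> (\<exists>\<pi>. (P has_vector_derivative \<pi>) (at t) \<and>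
        (\<forall>j. (\<pi> $ j > 0 \<longrightarrow> \<sigma> t $ j = 0) \<and> (\<pi> $ j < 0 \<longrightarrow> (\<forall>i. i \<noteq> j \<longrightarrow> \<sigma> t $ i = 0)))))"
    using sol[THEN conjunct2, THEN conjunct2, THEN conjunct2] by (rule exE)
  show thesis
  proof (rule that[of m N])
    show "abs_cont_on 0 b P" if "b \<ge> 0" for b using sol that by simp
    show "0 \<le> \<sigma> t $ j" "(\<Sum>j\<in>UNIV. \<sigma> t $ j) = \<rho> t" if "t \<ge> 0" for t j
      using sol[THEN conjunct2, THEN conjunct2, THEN conjunct1] that by auto
  qed (use m N in auto)
qed

lemma solution_shift:
  assumes "solution \<sigma> P"
  shows "solution (\<lambda>t. \<sigma> (t + T)) (\<lambda>t. P (t + T))"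
proof -
  obtain m N where AC: "\<And>b. b \<ge> 0 \<Longrightarrow> abs_cont_on 0 b P"
    and m: "\<And>t j. t \<ge> 0 \<Longrightarrow> \<sigma> t $ j = \<beta> j * (P t $ j - \<gamma> t j - m t)"
    and \<sigma>: "\<And>t j. t \<ge> 0 \<Longrightarrow> 0 \<le> \<sigma> t $ j" "\<And>t. t \<ge> 0 \<Longrightarrow> (\<Sum>j\<in>UNIV. \<sigma> t $ j) = \<rho> t"
    and N: "negligible N" and rate: "\<And>t. t \<ge> 0 \<Longrightarrow> t \<notin> N \<Longrightarrow> \<exists>\<pi>. (P has_vector_derivative \<pi>) (at t) \<and>
        (\<forall>j. (\<pi> $ j > 0 \<longrightarrow> \<sigma> t $ j = 0) \<and> (\<pi> $ j < 0 \<longrightarrow> (\<forall>i. i \<noteq> j \<longrightarrow> \<sigma> t $ i = 0)))"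
    by (rule solutionE[OF assms]) blast
  show ?thesis
    unfolding solution_def
  proof (intro conjI allI impI)
    fix b :: real assume "b \<ge> 0"
    then have "abs_cont_on (0 + T) (b + T) P"
      using AC[of "b + T"] T_pos by (auto intro: abs_cont_on_subinterval[of 0 "b + T"])
    then show "abs_cont_on 0 b (\<lambda>t. P (t + T))" by (rule abs_cont_on_shift)
  next
    show "\<exists>m'. \<forall>t\<ge>0. \<forall>j. \<sigma> (t + T) $ j = \<beta> j * (P (t + T) $ j - \<gamma> t j - m' t)"
      using m T_pos \<gamma>_periodic by (intro exI[of _ "\<lambda>t. m (t + T)"]) simp
  next
    fix t :: real and j assume "t \<ge> 0"
    then show "0 \<le> \<sigma> (t + T) $ j" "(\<Sum>j\<in>UNIV. \<sigma> (t + T) $ j) = \<rho> t"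
      using \<sigma>[of "t + T"] \<rho>_periodic T_pos by auto
  next
    have "negligible ((+) (- T) ` N)" using N by (rule negligible_translation)
    moreover have "\<exists>\<pi>. ((\<lambda>t. P (t + T)) has_vector_derivative \<pi>) (at t) \<and>
        (\<forall>j. (\<pi> $ j > 0 \<longrightarrow> \<sigma> (t + T) $ j = 0) \<and> (\<pi> $ j < 0 \<longrightarrow> (\<forall>i. i \<noteq> j \<longrightarrow> \<sigma> (t + T) $ i = 0)))"
      if t: "t \<ge> 0" "t \<notin> (+) (- T) ` N" for t
    proof -
      have "t + T \<notin> N" using t(2) by (auto simp: image_iff)
      then obtain \<pi> where \<pi>: "(P has_vector_derivative \<pi>) (at (t + T))"
        "\<forall>j. (\<pi> $ j > 0 \<longrightarrow> \<sigma> (t + T) $ j = 0) \<and> (\<pi> $ j < 0 \<longrightarrow> (\<forall>i. i \<noteq> j \<longrightarrow> \<sigma> (t + T) $ i = 0))"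
        using rate[of "t + T"] t(1) T_pos by auto
      have "((\<lambda>t. t + T) has_vector_derivative 1) (at t)"
        by (auto intro!: derivative_eq_intros)
      then have "((P \<circ> (\<lambda>t. t + T)) has_vector_derivative 1 *\<^sub>R \<pi>) (at t)"
        by (rule vector_diff_chain_at) (rule \<pi>(1))
      then show ?thesis using \<pi>(2) by (auto simp: o_def)
    qed
    ultimately show "\<exists>N. negligible N \<and> (\<forall>t\<ge>0. t \<notin> N \<longrightarrow> (\<exists>\<pi>. ((\<lambda>t. P (t + T)) has_vector_derivative \<pi>) (at t) \<and>
        (\<forall>j. (\<pi> $ j > 0 \<longrightarrow> \<sigma> (t + T) $ j = 0) \<and> (\<pi> $ j < 0 \<longrightarrow> (\<forall>i. i \<noteq> j \<longrightarrow> \<sigma> (t + T) $ i = 0)))))"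
      by blast
  qed
qed

lemma solution_shift_multiple:
  "solution \<sigma> P \<Longrightarrow> solution (\<lambda>t. \<sigma> (t + real k * T)) (\<lambda>t. P (t + real k * T))"
proof (induction k)
  case (Suc k)
  then show ?case
    using solution_shift[of "\<lambda>t. \<sigma> (t + real k * T)" "\<lambda>t. P (t + real k * T)"]
    by (simp add: algebra_simps)
qed simp

lemma solution_le_\<rho>:
  assumes "solution \<sigma> P" "t \<ge> 0"
  shows "\<sigma> t $ j \<le> \<rho> t"
proof -
  have "\<sigma> t $ j \<le> (\<Sum>j\<in>UNIV. \<sigma> t $ j)"
    by (rule member_le_sum) (use assms in \<open>auto simp: solution_def\<close>)
  then show ?thesis using assms by (simp add: solution_def)
qed

lemma solution_bounds:
  assumes "solution \<sigma> P" "t \<ge> 0"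
  shows "0 \<le> \<sigma> t $ j" "\<sigma> t $ j \<le> W j"
  using assms solution_le_\<rho>[OF assms, of j] \<rho>_le[OF assms(2), of j] by (auto simp: solution_def)

section \<open>Decay of the l1 distance of two solutions\<close>

definition flow_const :: real where
  "flow_const = 1 + sum \<beta> UNIV * (\<Sum>i\<in>UNIV. 1 / \<beta> i)"

lemma flow_const_ge_1: "flow_const \<ge> 1"
proof -
  have "sum \<beta> UNIV \<ge> 0" "(\<Sum>i\<in>UNIV. 1 / \<beta> i) \<ge> 0"
    using \<beta>_pos by (simp_all add: sum_nonneg less_imp_le)
  then show ?thesis by (simp add: flow_const_def)
qed

text \<open>The loading \<open>\<gamma>\<close> cancels in the difference and the zero sum
  eliminates the multipliers, so the difference is a linear function of \<open>P1 - P2\<close>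
  alone. Almost everywhere its rate satisfies the sign conditions of
  \<open>abs_rate_le_sgn_rate\<close>; integration gives the bound.\<close>

lemma variation_le_l1_decrease:
  assumes sol1: "solution \<sigma>1 P1" and sol2: "solution \<sigma>2 P2" and ab: "0 \<le> a" "a \<le> b"
  shows "\<bar>(\<sigma>1 b $ j - \<sigma>2 b $ j) - (\<sigma>1 a $ j - \<sigma>2 a $ j)\<bar>
    \<le> flow_const * ((\<Sum>i\<in>UNIV. \<bar>\<sigma>1 a $ i - \<sigma>2 a $ i\<bar>) - (\<Sum>i\<in>UNIV. \<bar>\<sigma>1 b $ i - \<sigma>2 b $ i\<bar>))"
proof -
  define B where "B = sum \<beta> UNIV"
  have B: "B > 0" unfolding B_def using \<beta>_pos by (intro sum_pos) auto
  \<comment> \<open>The mean weighted by \<open>\<beta>\<close> is the value that the zero sum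
    forces on the difference of the multipliers.\<close>
  define lin where "lin i y = \<beta> i * (y $ i - (\<Sum>k\<in>UNIV. \<beta> k * y $ k) / B)" for i and y :: "real^'m"
  have bl: "bounded_linear (lin i)" for i
    unfolding lin_def
    by (intro bounded_linear_mult_right[THEN bounded_linear_compose] bounded_linear_sub
        bounded_linear_vec_nth bounded_linear_divide[THEN bounded_linear_compose] bounded_linear_sum)
  define \<Delta> where "\<Delta> t = P1 t - P2 t" for t
  define \<delta> where "\<delta> i t = lin i (\<Delta> t)" for i t
  obtain m1 N1 where AC1: "\<And>b. b \<ge> 0 \<Longrightarrow> abs_cont_on 0 b P1"
    and m1: "\<And>t j. t \<ge> 0 \<Longrightarrow> \<sigma>1 t $ j = \<beta> j * (P1 t $ j - \<gamma> t j - m1 t)"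
    and sum1: "\<And>t. t \<ge> 0 \<Longrightarrow> (\<Sum>j\<in>UNIV. \<sigma>1 t $ j) = \<rho> t"
    and N1: "negligible N1" and rate1: "\<And>t. t \<ge> 0 \<Longrightarrow> t \<notin> N1 \<Longrightarrow> \<exists>\<pi>. (P1 has_vector_derivative \<pi>) (at t) \<and>
        (\<forall>j. (\<pi> $ j > 0 \<longrightarrow> \<sigma>1 t $ j = 0) \<and> (\<pi> $ j < 0 \<longrightarrow> (\<forall>i. i \<noteq> j \<longrightarrow> \<sigma>1 t $ i = 0)))"
    by (rule solutionE[OF sol1]) blast
  obtain m2 N2 where AC2: "\<And>b. b \<ge> 0 \<Longrightarrow> abs_cont_on 0 b P2"
    and m2: "\<And>t j. t \<ge> 0 \<Longrightarrow> \<sigma>2 t $ j = \<beta> j * (P2 t $ j - \<gamma> t j - m2 t)"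
    and sum2: "\<And>t. t \<ge> 0 \<Longrightarrow> (\<Sum>j\<in>UNIV. \<sigma>2 t $ j) = \<rho> t"
    and N2: "negligible N2" and rate2: "\<And>t. t \<ge> 0 \<Longrightarrow> t \<notin> N2 \<Longrightarrow> \<exists>\<pi>. (P2 has_vector_derivative \<pi>) (at t) \<and>
        (\<forall>j. (\<pi> $ j > 0 \<longrightarrow> \<sigma>2 t $ j = 0) \<and> (\<pi> $ j < 0 \<longrightarrow> (\<forall>i. i \<noteq> j \<longrightarrow> \<sigma>2 t $ i = 0)))"
    by (rule solutionE[OF sol2]) blast
  have sum_eq: "(\<Sum>j\<in>UNIV. \<sigma>1 t $ j) = (\<Sum>j\<in>UNIV. \<sigma>2 t $ j)" if "t \<ge> 0" for t
    using sum1 sum2 that by simp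
  have \<delta>: "\<delta> i t = \<sigma>1 t $ i - \<sigma>2 t $ i" if t: "t \<ge> 0" for i t
  proof -
    have diff: "\<sigma>1 t $ k - \<sigma>2 t $ k = \<beta> k * (\<Delta> t $ k) - \<beta> k * (m1 t - m2 t)" for k
      unfolding m1[OF t] m2[OF t] by (simp add: \<Delta>_def algebra_simps)
    have "0 = (\<Sum>k\<in>UNIV. \<sigma>1 t $ k - \<sigma>2 t $ k)" using sum_eq[OF t] by (simp add: sum_subtractf)
    also have "\<dots> = (\<Sum>k\<in>UNIV. \<beta> k * (\<Delta> t $ k)) - B * (m1 t - m2 t)"
      unfolding diff sum_subtractf B_def sum_distrib_right ..
    finally have "m1 t - m2 t = (\<Sum>k\<in>UNIV. \<beta> k * (\<Delta> t $ k)) / B"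
      using B by (simp add: field_simps)
    then show ?thesis using diff[of i] by (simp add: \<delta>_def lin_def algebra_simps)
  qed
  define Z where "Z i = {t. \<delta> i t = 0 \<and> (\<exists>d. d \<noteq> 0 \<and> (\<delta> i has_real_derivative d) (at t))}" for i
  have "countable (\<Union>i. Z i)"
    unfolding Z_def by (intro countable_UN countable_transversal_zeros) auto
  then have "negligible (\<Union>i. Z i)"
    by (simp add: negligible_iff_null_sets countable_imp_null_set_lborel null_sets_completionI)
  then have N: "negligible (N1 \<union> N2 \<union> (\<Union>i. Z i))" using N1 N2 by (intro negligible_Un)
  have derivs: "\<exists>d. (\<forall>i. (\<delta> i has_real_derivative d i) (at t)) \<and> (\<forall>i. \<delta> i t = 0 \<longrightarrow> d i = 0) \<and>
      (\<forall>j. \<bar>d j\<bar> \<le> - flow_const * (\<Sum>i\<in>UNIV. sgn (\<delta> i t) * d i))"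
    if t: "t \<in> {a..b} - (N1 \<union> N2 \<union> (\<Union>i. Z i))" for t
  proof -
    have t0: "t \<ge> 0" and tN: "t \<notin> N1" "t \<notin> N2" using t ab by auto
    obtain \<pi>1 where \<pi>1: "(P1 has_vector_derivative \<pi>1) (at t)"
      "\<And>j. \<pi>1 $ j > 0 \<Longrightarrow> \<sigma>1 t $ j = 0" "\<And>i j. \<pi>1 $ j < 0 \<Longrightarrow> i \<noteq> j \<Longrightarrow> \<sigma>1 t $ i = 0"
      using rate1[OF t0 tN(1)] by blast
    obtain \<pi>2 where \<pi>2: "(P2 has_vector_derivative \<pi>2) (at t)"
      "\<And>j. \<pi>2 $ j > 0 \<Longrightarrow> \<sigma>2 t $ j = 0" "\<And>i j. \<pi>2 $ j < 0 \<Longrightarrow> i \<noteq> j \<Longrightarrow> \<sigma>2 t $ i = 0"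
      using rate2[OF t0 tN(2)] by blast
    define d where "d i = lin i (\<pi>1 - \<pi>2)" for i
    define \<nu> where "\<nu> = (\<Sum>k\<in>UNIV. \<beta> k * (\<pi>1 - \<pi>2) $ k) / B"
    have d: "d i = \<beta> i * ((\<pi>1 $ i - \<pi>2 $ i) - \<nu>)" for i by (simp add: d_def lin_def \<nu>_def)
    have der: "(\<delta> i has_real_derivative d i) (at t)" for i
      unfolding \<delta>_def d_def \<Delta>_def has_real_derivative_iff_has_vector_derivative
      by (intro bounded_linear.has_vector_derivative[OF bl] has_vector_derivative_diff \<pi>1 \<pi>2)
    have zero: "d i = 0" if "\<delta> i t = 0" for i
      using t that der[of i] by (auto simp: Z_def)
    \<comment> \<open>If all other coordinates of \<open>\<sigma>'\<close> vanish, coordinate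
      \<open>j\<close> carries the whole sum \<open>\<rho> t\<close>, which no solution
      exceeds.\<close>
    have vertex: "\<sigma> t $ j \<le> \<sigma>' t $ j"
      if "solution \<sigma> P" "solution \<sigma>' P'" "\<And>i. i \<noteq> j \<Longrightarrow> \<sigma>' t $ i = 0" for \<sigma> \<sigma>' P P' j
    proof -
      have "\<sigma> t $ j \<le> \<rho> t" using solution_le_\<rho>[OF that(1) t0] .
      also have "\<rho> t = (\<Sum>i\<in>UNIV. \<sigma>' t $ i)" using that(2) t0 by (simp add: solution_def)
      also have "\<dots> = (\<Sum>i\<in>{j}. \<sigma>' t $ i)" by (rule sum.mono_neutral_right) (use that(3) in auto)
      finally show ?thesis by simp
    qed
    have nonneg: "0 \<le> \<sigma>1 t $ i" "0 \<le> \<sigma>2 t $ i" for i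
      using solution_bounds(1)[OF sol1 t0] solution_bounds(1)[OF sol2 t0] by auto
    have pos: "d i \<le> - \<beta> i * \<nu>" if "\<delta> i t > 0" for i
    proof -
      have gt: "\<sigma>1 t $ i > \<sigma>2 t $ i" using that \<delta>[OF t0] by simp
      then have "\<pi>1 $ i \<le> 0" using \<pi>1(2)[of i] nonneg(2)[of i] by force
      moreover have "\<pi>2 $ i \<ge> 0" using vertex[OF sol1 sol2, of i] \<pi>2(3)[of i] gt by force
      ultimately have "\<beta> i * (\<pi>1 $ i - \<pi>2 $ i) \<le> 0" using \<beta>_pos[of i] by (simp add: mult_le_0_iff)
      then show ?thesis by (simp add: d algebra_simps)
    qed
    have neg: "d i \<ge> - \<beta> i * \<nu>" if "\<delta> i t < 0" for i
    proof -
      have lt: "\<sigma>1 t $ i < \<sigma>2 t $ i" using that \<delta>[OF t0] by simp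
      then have "\<pi>2 $ i \<le> 0" using \<pi>2(2)[of i] nonneg(1)[of i] by force
      moreover have "\<pi>1 $ i \<ge> 0" using vertex[OF sol2 sol1, of i] \<pi>1(3)[of i] lt by force
      ultimately have "\<beta> i * (\<pi>1 $ i - \<pi>2 $ i) \<ge> 0" using \<beta>_pos[of i] by simp
      then show ?thesis by (simp add: d algebra_simps)
    qed
    have "sum d UNIV = (\<Sum>i\<in>UNIV. \<beta> i * (\<pi>1 - \<pi>2) $ i) - (\<Sum>i\<in>UNIV. \<beta> i) * \<nu>"
      by (simp add: d sum_subtractf right_diff_distrib sum_distrib_right)
    also have "\<dots> = 0" using B by (simp add: \<nu>_def B_def)
    finally have sumd: "sum d UNIV = 0" .
    have "(\<Sum>i\<in>UNIV. \<delta> i t) = 0" using sum_eq[OF t0] by (simp add: \<delta>[OF t0] sum_subtractf)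
    then have "\<bar>d j\<bar> \<le> - flow_const * (\<Sum>i\<in>UNIV. sgn (\<delta> i t) * d i)" for j
      unfolding flow_const_def using zero pos neg
      by (intro abs_rate_le_sgn_rate[where \<nu>=\<nu>] \<beta>_pos sumd)
    then show ?thesis using der zero by blast
  qed
  have "\<forall>i. \<exists>C. \<forall>y. norm (lin i y) \<le> norm y * C" using bounded_linear.bounded[OF bl] by blast
  then obtain C where C: "\<And>i y. norm (lin i y) \<le> norm y * C i" by metis
  have \<delta>_lip: "\<bar>\<delta> i y - \<delta> i x\<bar> \<le> C i * norm (\<Delta> y - \<Delta> x)" for i x y
    using C[of i "\<Delta> y - \<Delta> x"] by (simp add: \<delta>_def linear_diff[OF bounded_linear.linear[OF bl]] mult.commute)
  have AC\<Delta>: "abs_cont_on a b \<Delta>"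
    unfolding \<Delta>_def
    by (rule abs_cont_on_diff; rule abs_cont_on_subinterval[OF _ ab(1) order.refl]) (use AC1 AC2 ab in auto)
  define \<Phi> where "\<Phi> t = (\<Sum>i\<in>UNIV. \<bar>\<delta> i t\<bar>)" for t
  \<comment> \<open>For each sign \<open>\<epsilon>\<close> the bound is the monotonicity of one
    function \<open>F\<close>; the two signs together give the absolute value.\<close>
  have one_sided: "\<epsilon> * \<delta> j b - \<epsilon> * \<delta> j a \<le> flow_const * (\<Phi> a - \<Phi> b)" if \<epsilon>: "\<bar>\<epsilon>\<bar> = 1" for \<epsilon>
  proof -
    define F where "F t = - flow_const * \<Phi> t - \<epsilon> * \<delta> j t" for t
    have "F a \<le> F b"
    proof (rule abs_cont_on_AE_deriv_nonneg_imp_le[OF _ ab(2) N])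
      show "abs_cont_on a b F"
      proof (rule abs_cont_on_dominated[OF AC\<Delta>])
        fix x y
        have "\<bar>\<Phi> y - \<Phi> x\<bar> \<le> (\<Sum>i\<in>UNIV. \<bar>\<bar>\<delta> i y\<bar> - \<bar>\<delta> i x\<bar>\<bar>)"
          unfolding \<Phi>_def sum_subtractf[symmetric] by (rule sum_abs)
        also have "\<dots> \<le> (\<Sum>i\<in>UNIV. C i * norm (\<Delta> y - \<Delta> x))"
          by (rule sum_mono) (metis \<delta>_lip abs_triangle_ineq3 order_trans)
        finally have 1: "\<bar>\<Phi> y - \<Phi> x\<bar> \<le> sum C UNIV * norm (\<Delta> y - \<Delta> x)"
          by (simp add: sum_distrib_right)
        have "F y - F x = flow_const * (\<Phi> x - \<Phi> y) + \<epsilon> * (\<delta> j x - \<delta> j y)"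
          by (simp add: F_def algebra_simps)
        then have "\<bar>F y - F x\<bar> \<le> \<bar>flow_const * (\<Phi> x - \<Phi> y)\<bar> + \<bar>\<epsilon> * (\<delta> j x - \<delta> j y)\<bar>"
          using abs_triangle_ineq by simp
        also have "\<dots> = flow_const * \<bar>\<Phi> y - \<Phi> x\<bar> + \<bar>\<delta> j y - \<delta> j x\<bar>"
          using flow_const_ge_1 \<epsilon> by (simp add: abs_mult abs_minus_commute)
        also have "\<dots> \<le> flow_const * (sum C UNIV * norm (\<Delta> y - \<Delta> x)) + C j * norm (\<Delta> y - \<Delta> x)"
          using flow_const_ge_1 by (intro add_mono mult_left_mono 1 \<delta>_lip) auto
        finally show "norm (F y - F x) \<le> (flow_const * sum C UNIV + C j) * norm (\<Delta> y - \<Delta> x)"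
          by (simp add: algebra_simps)
      qed
      fix t assume t: "t \<in> {a..b} - (N1 \<union> N2 \<union> (\<Union>i. Z i))"
      obtain d where "(\<forall>i. (\<delta> i has_real_derivative d i) (at t)) \<and> (\<forall>i. \<delta> i t = 0 \<longrightarrow> d i = 0) \<and>
          (\<forall>j. \<bar>d j\<bar> \<le> - flow_const * (\<Sum>i\<in>UNIV. sgn (\<delta> i t) * d i))"
        using derivs[OF t] by (rule exE)
      then have d: "\<And>i. (\<delta> i has_real_derivative d i) (at t)" "\<And>i. \<delta> i t = 0 \<Longrightarrow> d i = 0"
        "\<And>j. \<bar>d j\<bar> \<le> - flow_const * (\<Sum>i\<in>UNIV. sgn (\<delta> i t) * d i)"
        by auto
      have "(F has_real_derivative - flow_const * (\<Sum>i\<in>UNIV. sgn (\<delta> i t) * d i) - \<epsilon> * d j) (at t)"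
        unfolding F_def \<Phi>_def
        by (intro DERIV_diff DERIV_cmult DERIV_sum has_real_derivative_abs d) (simp_all add: d)
      moreover have "- flow_const * (\<Sum>i\<in>UNIV. sgn (\<delta> i t) * d i) - \<epsilon> * d j \<ge> 0"
      proof -
        have "\<epsilon> * d j \<le> \<bar>d j\<bar>" using \<epsilon> by (metis abs_ge_self abs_mult mult_1)
        then show ?thesis using d(3)[of j] by simp
      qed
      ultimately show "\<exists>d\<ge>0. (F has_real_derivative d) (at t)" by blast
    qed
    then show ?thesis by (simp add: F_def algebra_simps)
  qed
  have "\<bar>\<delta> j b - \<delta> j a\<bar> \<le> flow_const * (\<Phi> a - \<Phi> b)"
    using one_sided[of 1] one_sided[of "-1"] by (simp add: abs_le_iff)
  then show ?thesis using ab by (simp add: \<Phi>_def \<delta>)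
qed

section \<open>Contact with the facets and contraction\<close>

lemma \<gamma>_periodic_multiple: "0 \<le> t \<Longrightarrow> \<gamma> (t + real k * T) j = \<gamma> t j"
proof (induction k)
  case (Suc k)
  have "\<gamma> (t + real (Suc k) * T) j = \<gamma> (t + real k * T + T) j" by (simp add: algebra_simps)
  also have "\<dots> = \<gamma> (t + real k * T) j" using Suc.prems T_pos by (intro \<gamma>_periodic) simp
  finally show ?case using Suc by simp
qed simp

text \<open>If \<open>\<sigma> $ j\<close> stayed positive for long, all the differences \<open>P $ i - P $ j\<close> would be nondecreasing.
  They are bounded, but the displacement loading makes one of them grow by a fixed amount in each period.\<close>

lemma ex_uniform_contact_time:
  "\<exists>n::nat. \<forall>\<sigma> P j. solution \<sigma> P \<longrightarrow> (\<exists>\<tau>. 0 \<le> \<tau> \<and> \<tau> \<le> real n * T \<and> \<sigma> \<tau> $ j = 0)"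
proof -
  \<comment> \<open>The times \<open>t1\<close> and \<open>t2\<close> need not lie in one period;
    \<open>p\<close> is a multiple of \<open>T\<close> beyond both.\<close>
  obtain k :: nat where k: "t2 < real k * T" using ex_less_of_nat_mult[OF T_pos] by blast
  define p where "p = real k * T"
  have p: "t2 < p" "p > 0" using k t12 by (auto simp: p_def)
  define S where "S = (\<Sum>i\<in>UNIV. \<bar>W i\<bar> / \<beta> i)"
  have S: "\<bar>W i\<bar> / \<beta> i \<le> S" for i
    unfolding S_def by (rule member_le_sum) (use \<beta>_pos in \<open>auto simp: less_imp_le\<close>)
  \<comment> \<open>\<open>2 * S + 2 * \<Gamma>\<close> bounds each difference \<open>Q i\<close>
    below, through the elastic ranges and the loading; \<open>M\<close> is the resulting bound for
    the weighted sum \<open>f\<close>. \<open>N\<close> increments of size \<open>c0\<close> then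
    exceed the possible range \<open>2 * M\<close>.\<close>
  define M where "M = (2 * S + 2 * \<Gamma>) * (\<Sum>i\<in>UNIV. sqrt (\<beta> i))"
  obtain N :: nat where N: "2 * M < real N * c0" using ex_less_of_nat_mult[OF c0] by blast
  have "\<exists>\<tau>. 0 \<le> \<tau> \<and> \<tau> \<le> real (N * k) * T \<and> \<sigma> \<tau> $ j = 0" if sol: "solution \<sigma> P" for \<sigma> P j
  proof (rule ccontr)
    assume contra: "\<not> ?thesis"
    obtain m N0 where AC: "\<And>b. b \<ge> 0 \<Longrightarrow> abs_cont_on 0 b P"
      and m: "\<And>t j. t \<ge> 0 \<Longrightarrow> \<sigma> t $ j = \<beta> j * (P t $ j - \<gamma> t j - m t)"
      and N0: "negligible N0" and rate: "\<And>t. t \<ge> 0 \<Longrightarrow> t \<notin> N0 \<Longrightarrow> \<exists>\<pi>. (P has_vector_derivative \<pi>) (at t) \<and>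
          (\<forall>j. (\<pi> $ j > 0 \<longrightarrow> \<sigma> t $ j = 0) \<and> (\<pi> $ j < 0 \<longrightarrow> (\<forall>i. i \<noteq> j \<longrightarrow> \<sigma> t $ i = 0)))"
      by (rule solutionE[OF sol]) blast
    have Np: "real (N * k) * T = real N * p" by (simp add: p_def)
    have pos: "\<sigma> t $ j \<noteq> 0" if "0 \<le> t" "t \<le> real N * p" for t
      using contra that unfolding Np by blast
    define Q where "Q i t = P t $ i - P t $ j" for i t
    have Q_mono: "Q i x \<le> Q i y" if xy: "0 \<le> x" "x \<le> y" "y \<le> real N * p" for i x y
    proof (rule abs_cont_on_AE_deriv_nonneg_imp_le[OF _ xy(2) N0])
      have "abs_cont_on x y P" using AC[of y] xy by (auto intro: abs_cont_on_subinterval[of 0 y])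
      then show "abs_cont_on x y (Q i)"
      proof (rule abs_cont_on_dominated)
        fix s t
        have "\<bar>Q i t - Q i s\<bar> \<le> \<bar>(P t - P s) $ i\<bar> + \<bar>(P t - P s) $ j\<bar>" by (simp add: Q_def)
        also have "\<dots> \<le> norm (P t - P s) + norm (P t - P s)"
          by (intro add_mono component_le_norm_cart)
        finally show "norm (Q i t - Q i s) \<le> 2 * norm (P t - P s)" by simp
      qed
      fix t assume t: "t \<in> {x..y} - N0"
      then have t0: "0 \<le> t" "t \<le> real N * p" using xy by auto
      obtain \<pi> where \<pi>: "(P has_vector_derivative \<pi>) (at t)"
        "\<And>j. \<pi> $ j > 0 \<Longrightarrow> \<sigma> t $ j = 0" "\<And>i j. \<pi> $ j < 0 \<Longrightarrow> i \<noteq> j \<Longrightarrow> \<sigma> t $ i = 0"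
        using rate[OF t0(1)] t by blast
      have "(Q i has_real_derivative \<pi> $ i - \<pi> $ j) (at t)"
        unfolding Q_def has_real_derivative_iff_has_vector_derivative
        by (intro has_vector_derivative_diff bounded_linear.has_vector_derivative[OF bounded_linear_vec_nth] \<pi>)
      moreover have "\<pi> $ i - \<pi> $ j \<ge> 0"
      proof (cases "i = j")
        case False
        have "\<pi> $ j \<le> 0" using \<pi>(2)[of j] pos[OF t0] by force
        moreover have "\<pi> $ i \<ge> 0" using \<pi>(3)[of i j] pos[OF t0] False by force
        ultimately show ?thesis by simp
      qed simp
      ultimately show "\<exists>d\<ge>0. (Q i has_real_derivative d) (at t)" by blast
    qed
    have Q_bound: "\<bar>Q i t\<bar> \<le> 2 * S + 2 * \<Gamma>" if t: "t \<ge> 0" for i t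
    proof -
      have frac: "0 \<le> \<sigma> t $ l / \<beta> l" "\<sigma> t $ l / \<beta> l \<le> S" for l
      proof -
        show "0 \<le> \<sigma> t $ l / \<beta> l" using solution_bounds(1)[OF sol t] \<beta>_pos[of l] by simp
        have "\<sigma> t $ l / \<beta> l \<le> \<bar>W l\<bar> / \<beta> l"
          using solution_bounds(2)[OF sol t, of l] \<beta>_pos[of l] by (intro divide_right_mono) auto
        then show "\<sigma> t $ l / \<beta> l \<le> S" using S[of l] by simp
      qed
      have "P t $ l = \<sigma> t $ l / \<beta> l + \<gamma> t l + m t" for l
        using m[OF t, of l] \<beta>_pos[of l] by (simp add: field_simps)
      then have "Q i t = \<sigma> t $ i / \<beta> i + \<gamma> t i - \<sigma> t $ j / \<beta> j - \<gamma> t j" by (simp add: Q_def)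
      then show ?thesis using frac[of i] frac[of j] \<gamma>_bounded[OF t, of i] \<gamma>_bounded[OF t, of j] by linarith
    qed
    define f where "f t = (\<Sum>i\<in>UNIV. sqrt (\<beta> i) * Q i t)" for t
    have f_mono: "f x \<le> f y" if "0 \<le> x" "x \<le> y" "y \<le> real N * p" for x y
      unfolding f_def using Q_mono[OF that] \<beta>_pos by (intro sum_mono mult_left_mono) (auto simp: less_imp_le)
    have f_bound: "\<bar>f t\<bar> \<le> M" if "t \<ge> 0" for t
    proof -
      have "\<bar>f t\<bar> \<le> (\<Sum>i\<in>UNIV. \<bar>sqrt (\<beta> i) * Q i t\<bar>)" unfolding f_def by (rule sum_abs)
      also have "\<dots> \<le> (\<Sum>i\<in>UNIV. sqrt (\<beta> i) * (2 * S + 2 * \<Gamma>))"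
        using \<beta>_pos Q_bound[OF that] by (intro sum_mono) (auto simp: abs_mult less_imp_le intro!: mult_left_mono)
      finally show ?thesis by (simp add: M_def sum_distrib_right[symmetric] mult.commute)
    qed
    have growth: "f (real n * p) + c0 \<le> f (real (Suc n) * p)" if n: "n < N" for n
    proof -
      define x where "x = t1 + real n * p"
      define y where "y = t2 + real n * p"
      have "real (Suc n) * p \<le> real N * p" using n p by (intro mult_right_mono) auto
      then have xy: "0 \<le> real n * p" "real n * p \<le> x" "0 \<le> x" "x \<le> y" "0 \<le> y" "y \<le> real (Suc n) * p" "real (Suc n) * p \<le> real N * p"
        using p t12 by (auto simp: x_def y_def algebra_simps)
      have np: "real n * p = real (n * k) * T" by (simp add: p_def)
      have \<gamma>: "\<gamma> x i = \<gamma> t1 i" "\<gamma> y i = \<gamma> t2 i" for i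
        unfolding x_def y_def np by (rule \<gamma>_periodic_multiple; use t12 in simp)+
      \<comment> \<open>The free shift in \<open>large\<close> absorbs the multiplier and the
        reference component of \<open>P\<close>; what is left are the increments of \<open>Q\<close>
        and an elastic part of norm at most that of the widths.\<close>
      define z where "z = m y - m x - (P y $ j - P x $ j)"
      have incr: "\<gamma> t2 i - \<gamma> t1 i + z = (Q i y - Q i x) + - ((\<sigma> y $ i - \<sigma> x $ i) / \<beta> i)" for i
        using m[OF xy(3), of i] m[OF xy(5), of i] \<beta>_pos[of i]
        by (simp add: \<gamma>[symmetric] z_def Q_def field_simps)
      have "c0 + L2_set (\<lambda>i. W i / sqrt (\<beta> i)) UNIV
          \<le> L2_set (\<lambda>i. sqrt (\<beta> i) * (Q i y - Q i x) + sqrt (\<beta> i) * - ((\<sigma> y $ i - \<sigma> x $ i) / \<beta> i)) UNIV"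
        using large[of z] unfolding incr by (simp only: distrib_left)
      also have "\<dots> \<le> L2_set (\<lambda>i. sqrt (\<beta> i) * (Q i y - Q i x)) UNIV
          + L2_set (\<lambda>i. sqrt (\<beta> i) * - ((\<sigma> y $ i - \<sigma> x $ i) / \<beta> i)) UNIV"
        by (rule L2_set_triangle_ineq)
      also have "L2_set (\<lambda>i. sqrt (\<beta> i) * - ((\<sigma> y $ i - \<sigma> x $ i) / \<beta> i)) UNIV \<le> L2_set (\<lambda>i. W i / sqrt (\<beta> i)) UNIV"
        unfolding L2_set_def
      proof (intro real_sqrt_le_mono sum_mono)
        fix i
        have "\<bar>\<sigma> y $ i - \<sigma> x $ i\<bar> \<le> W i"
          using solution_bounds[OF sol xy(3), of i] solution_bounds[OF sol xy(5), of i] by linarith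
        then have "\<bar>\<sigma> y $ i - \<sigma> x $ i\<bar> / sqrt (\<beta> i) \<le> W i / sqrt (\<beta> i)"
          using \<beta>_pos[of i] by (intro divide_right_mono) auto
        moreover have "\<bar>sqrt (\<beta> i) * - ((\<sigma> y $ i - \<sigma> x $ i) / \<beta> i)\<bar> = \<bar>\<sigma> y $ i - \<sigma> x $ i\<bar> / sqrt (\<beta> i)"
        proof -
          have "sqrt (\<beta> i) / \<beta> i = 1 / sqrt (\<beta> i)"
            using real_div_sqrt[of "\<beta> i"] \<beta>_pos[of i] by (simp add: field_simps)
          then have "sqrt (\<beta> i) * - ((\<sigma> y $ i - \<sigma> x $ i) / \<beta> i) = - ((\<sigma> y $ i - \<sigma> x $ i) * (1 / sqrt (\<beta> i)))"
            by (metis mult.commute mult_minus_right times_divide_eq_left times_divide_eq_right)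
          then show ?thesis using \<beta>_pos[of i] by (simp add: abs_divide)
        qed
        ultimately have "\<bar>sqrt (\<beta> i) * - ((\<sigma> y $ i - \<sigma> x $ i) / \<beta> i)\<bar> \<le> \<bar>W i / sqrt (\<beta> i)\<bar>" by linarith
        then show "(sqrt (\<beta> i) * - ((\<sigma> y $ i - \<sigma> x $ i) / \<beta> i))\<^sup>2 \<le> (W i / sqrt (\<beta> i))\<^sup>2"
          by (simp only: abs_le_square_iff)
      qed
      finally have "c0 \<le> L2_set (\<lambda>i. sqrt (\<beta> i) * (Q i y - Q i x)) UNIV" by simp
      \<comment> \<open>For nonnegative increments the Euclidean norm is at most the sum, and the
        sum, unlike the norm, telescopes over the periods.\<close>
      also have "\<dots> \<le> (\<Sum>i\<in>UNIV. sqrt (\<beta> i) * (Q i y - Q i x))"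
        using Q_mono[OF xy(3,4)] xy \<beta>_pos by (intro L2_set_le_sum mult_nonneg_nonneg) (auto simp: less_imp_le)
      also have "\<dots> = f y - f x" by (simp add: f_def right_diff_distrib sum_subtractf)
      finally show ?thesis
        using f_mono[of "real n * p" x] f_mono[of y "real (Suc n) * p"] xy by linarith
    qed
    have "f 0 + real n * c0 \<le> f (real n * p)" if "n \<le> N" for n
      using that
    proof (induction n)
      case (Suc n)
      then show ?case using growth[of n] by (simp add: algebra_simps)
    qed simp
    from this[of N] have "f 0 + real N * c0 \<le> f (real N * p)" by simp
    moreover have "real N * p \<ge> 0" using p by simp
    ultimately show False using f_bound[of 0] f_bound[of "real N * p"] N by linarith
  qed
  then show ?thesis by blast
qed

lemma l1_distance_antimono:
  assumes "solution \<sigma>1 P1" "solution \<sigma>2 P2" "0 \<le> a" "a \<le> b"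
  shows "(\<Sum>i\<in>UNIV. \<bar>\<sigma>1 b $ i - \<sigma>2 b $ i\<bar>) \<le> (\<Sum>i\<in>UNIV. \<bar>\<sigma>1 a $ i - \<sigma>2 a $ i\<bar>)"
proof -
  have "0 \<le> flow_const * ((\<Sum>i\<in>UNIV. \<bar>\<sigma>1 a $ i - \<sigma>2 a $ i\<bar>) - (\<Sum>i\<in>UNIV. \<bar>\<sigma>1 b $ i - \<sigma>2 b $ i\<bar>))"
    by (rule order_trans[OF abs_ge_zero variation_le_l1_decrease[OF assms]])
  then show ?thesis using flow_const_ge_1 by (simp add: zero_le_mult_iff)
qed

text \<open>A positive coordinate of \<open>\<sigma>1 - \<sigma>2\<close> has lost its sign at the time when \<open>\<sigma>1\<close> touches the facet.\<close>

lemma l1_distance_contraction: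
  "\<exists>(n::nat) \<theta>. 0 \<le> \<theta> \<and> \<theta> < 1 \<and> (\<forall>\<sigma>1 P1 \<sigma>2 P2. solution \<sigma>1 P1 \<longrightarrow> solution \<sigma>2 P2 \<longrightarrow>
     (\<Sum>i\<in>UNIV. \<bar>\<sigma>1 (real n * T) $ i - \<sigma>2 (real n * T) $ i\<bar>) \<le> \<theta> * (\<Sum>i\<in>UNIV. \<bar>\<sigma>1 0 $ i - \<sigma>2 0 $ i\<bar>))"
proof -
  obtain n :: nat where n: "\<And>\<sigma> P j. solution \<sigma> P \<Longrightarrow> \<exists>\<tau>. 0 \<le> \<tau> \<and> \<tau> \<le> real n * T \<and> \<sigma> \<tau> $ j = 0"
    using ex_uniform_contact_time by blast
  \<comment> \<open>Each initial difference is at most \<open>flow_const\<close> times the decrease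
    of \<open>\<Phi>\<close>. Summed over the springs this reads
    \<open>\<Phi> 0 \<le> C * (\<Phi> 0 - \<Phi> (real n * T))\<close>, whence the factor
    \<open>1 - 1 / C\<close>.\<close>
  define C where "C = real CARD('m) * flow_const"
  have "real CARD('m) \<ge> 1" by (simp add: Suc_le_eq)
  then have C: "C \<ge> 1" unfolding C_def using flow_const_ge_1 mult_mono[of 1 "real CARD('m)" 1 flow_const] by simp
  have "(\<Sum>i\<in>UNIV. \<bar>\<sigma>1 (real n * T) $ i - \<sigma>2 (real n * T) $ i\<bar>) \<le> (1 - 1 / C) * (\<Sum>i\<in>UNIV. \<bar>\<sigma>1 0 $ i - \<sigma>2 0 $ i\<bar>)"
    if sol: "solution \<sigma>1 P1" "solution \<sigma>2 P2" for \<sigma>1 P1 \<sigma>2 P2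
  proof -
    define \<Phi> where "\<Phi> t = (\<Sum>i\<in>UNIV. \<bar>\<sigma>1 t $ i - \<sigma>2 t $ i\<bar>)" for t
    have "\<bar>\<sigma>1 0 $ j - \<sigma>2 0 $ j\<bar> \<le> flow_const * (\<Phi> 0 - \<Phi> (real n * T))" for j
    proof -
      \<comment> \<open>The contact time is taken for the solution with the larger initial
        coordinate; by then the difference has travelled at least its initial size.\<close>
      obtain \<tau> where \<tau>: "0 \<le> \<tau>" "\<tau> \<le> real n * T"
        "\<bar>\<sigma>1 0 $ j - \<sigma>2 0 $ j\<bar> \<le> \<bar>(\<sigma>1 \<tau> $ j - \<sigma>2 \<tau> $ j) - (\<sigma>1 0 $ j - \<sigma>2 0 $ j)\<bar>"
      proof (cases "\<sigma>1 0 $ j \<ge> \<sigma>2 0 $ j")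
        case True
        obtain \<tau> where \<tau>: "0 \<le> \<tau>" "\<tau> \<le> real n * T" "\<sigma>1 \<tau> $ j = 0" using n[OF sol(1)] by blast
        then show thesis using solution_bounds(1)[OF sol(2) \<tau>(1), of j] True by (intro that[of \<tau>]) auto
      next
        case False
        obtain \<tau> where \<tau>: "0 \<le> \<tau>" "\<tau> \<le> real n * T" "\<sigma>2 \<tau> $ j = 0" using n[OF sol(2)] by blast
        then show thesis using solution_bounds(1)[OF sol(1) \<tau>(1), of j] False by (intro that[of \<tau>]) auto
      qed
      note \<tau>(3)
      also have "\<bar>(\<sigma>1 \<tau> $ j - \<sigma>2 \<tau> $ j) - (\<sigma>1 0 $ j - \<sigma>2 0 $ j)\<bar> \<le> flow_const * (\<Phi> 0 - \<Phi> \<tau>)"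
        unfolding \<Phi>_def by (rule variation_le_l1_decrease[OF sol order.refl \<tau>(1)])
      also have "\<dots> \<le> flow_const * (\<Phi> 0 - \<Phi> (real n * T))"
        using l1_distance_antimono[OF sol \<tau>(1,2)] flow_const_ge_1 unfolding \<Phi>_def by (intro mult_left_mono) auto
      finally show ?thesis .
    qed
    then have "\<Phi> 0 \<le> (\<Sum>j\<in>(UNIV::'m set). flow_const * (\<Phi> 0 - \<Phi> (real n * T)))"
      unfolding \<Phi>_def[of 0] by (intro sum_mono) (simp add: \<Phi>_def)
    then have "\<Phi> 0 \<le> C * (\<Phi> 0 - \<Phi> (real n * T))" by (simp add: C_def)
    then have "\<Phi> (real n * T) \<le> (1 - 1 / C) * \<Phi> 0" using C by (simp add: field_simps)
    then show ?thesis by (simp add: \<Phi>_def)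
  qed
  moreover have "0 \<le> 1 - 1 / C" "1 - 1 / C < 1" using C by auto
  ultimately show ?thesis by blast
qed

text \<open>Time shifts by periods are again solutions, so the contraction can be iterated. All
  initial distances are at most the sum of the widths, which makes the merging time independent of
  the solutions.\<close>

lemma solutions_merge:
  assumes "\<epsilon> > 0"
  shows "\<exists>\<tau>. \<forall>\<sigma>1 P1 \<sigma>2 P2 t. solution \<sigma>1 P1 \<longrightarrow> solution \<sigma>2 P2 \<longrightarrow> t \<ge> \<tau> \<longrightarrow>
    (\<Sum>i\<in>UNIV. \<bar>\<sigma>1 t $ i - \<sigma>2 t $ i\<bar>) \<le> \<epsilon>"
proof -
  obtain n :: nat and \<theta> where \<theta>: "0 \<le> \<theta>" "\<theta> < 1" and contr: "\<And>\<sigma>1 P1 \<sigma>2 P2. solution \<sigma>1 P1 \<Longrightarrow> solution \<sigma>2 P2 \<Longrightarrow>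
     (\<Sum>i\<in>UNIV. \<bar>\<sigma>1 (real n * T) $ i - \<sigma>2 (real n * T) $ i\<bar>) \<le> \<theta> * (\<Sum>i\<in>UNIV. \<bar>\<sigma>1 0 $ i - \<sigma>2 0 $ i\<bar>)"
    using l1_distance_contraction by blast
  have iter: "(\<Sum>i\<in>UNIV. \<bar>\<sigma>1 (real (k * n) * T) $ i - \<sigma>2 (real (k * n) * T) $ i\<bar>) \<le> \<theta> ^ k * (\<Sum>i\<in>UNIV. \<bar>\<sigma>1 0 $ i - \<sigma>2 0 $ i\<bar>)"
    if sol: "solution \<sigma>1 P1" "solution \<sigma>2 P2" for \<sigma>1 P1 \<sigma>2 P2 k
  proof (induction k)
    case (Suc k)
    have eq: "real n * T + real (k * n) * T = real (Suc k * n) * T" by (simp add: algebra_simps)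
    have "(\<Sum>i\<in>UNIV. \<bar>\<sigma>1 (real (Suc k * n) * T) $ i - \<sigma>2 (real (Suc k * n) * T) $ i\<bar>)
        \<le> \<theta> * (\<Sum>i\<in>UNIV. \<bar>\<sigma>1 (real (k * n) * T) $ i - \<sigma>2 (real (k * n) * T) $ i\<bar>)"
      using contr[OF solution_shift_multiple[OF sol(1), of "k * n"] solution_shift_multiple[OF sol(2), of "k * n"]]
      unfolding eq by simp
    also have "\<dots> \<le> \<theta> * (\<theta> ^ k * (\<Sum>i\<in>UNIV. \<bar>\<sigma>1 0 $ i - \<sigma>2 0 $ i\<bar>))"
      using Suc \<theta>(1) by (rule mult_left_mono)
    finally show ?case by (simp add: mult.assoc)
  qed simp
  define M where "M = (\<Sum>i\<in>UNIV. \<bar>W i\<bar>)"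
  have M: "(\<Sum>i\<in>UNIV. \<bar>\<sigma>1 0 $ i - \<sigma>2 0 $ i\<bar>) \<le> M"
    if sol: "solution \<sigma>1 P1" "solution \<sigma>2 P2" for \<sigma>1 P1 \<sigma>2 P2
    unfolding M_def
  proof (rule sum_mono)
    fix i show "\<bar>\<sigma>1 0 $ i - \<sigma>2 0 $ i\<bar> \<le> \<bar>W i\<bar>"
      using solution_bounds[OF sol(1) order.refl, of i] solution_bounds[OF sol(2) order.refl, of i] by linarith
  qed
  have "(\<lambda>k. \<theta> ^ k * M) \<longlonglongrightarrow> 0 * M"
    using \<theta> by (intro tendsto_mult tendsto_const LIMSEQ_realpow_zero)
  then have "(\<lambda>k. \<theta> ^ k * M) \<longlonglongrightarrow> 0" by simp
  from order_tendstoD(2)[OF this assms] obtain k where k: "\<theta> ^ k * M < \<epsilon>"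
    unfolding eventually_sequentially by blast
  show ?thesis
  proof (intro exI[of _ "real (k * n) * T"] allI impI)
    fix \<sigma>1 P1 \<sigma>2 P2 and t :: real
    assume sol: "solution \<sigma>1 P1" "solution \<sigma>2 P2" and t: "t \<ge> real (k * n) * T"
    have "(\<Sum>i\<in>UNIV. \<bar>\<sigma>1 t $ i - \<sigma>2 t $ i\<bar>) \<le> (\<Sum>i\<in>UNIV. \<bar>\<sigma>1 (real (k * n) * T) $ i - \<sigma>2 (real (k * n) * T) $ i\<bar>)"
      using T_pos by (intro l1_distance_antimono[OF sol _ t]) simp
    also have "\<dots> \<le> \<theta> ^ k * (\<Sum>i\<in>UNIV. \<bar>\<sigma>1 0 $ i - \<sigma>2 0 $ i\<bar>)" by (rule iter[OF sol])
    also have "\<dots> \<le> \<theta> ^ k * M" using \<theta> M[OF sol] by (intro mult_left_mono) auto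
    finally show "(\<Sum>i\<in>UNIV. \<bar>\<sigma>1 t $ i - \<sigma>2 t $ i\<bar>) \<le> \<epsilon>" using k by simp
  qed
qed

lemma ex_periodic_attracting_solution:
  "\<exists>\<sigma>0. (\<forall>t. \<sigma>0 (t + T) = \<sigma>0 t) \<and>
     (\<forall>\<sigma> P. solution \<sigma> P \<longrightarrow> ((\<lambda>t. norm (\<sigma> t - \<sigma>0 t)) \<longlongrightarrow> 0) at_top)"
proof -
  define S where "S = {\<sigma>. \<exists>P. solution \<sigma> P}"
  have "\<exists>\<sigma>0. (\<forall>t. \<sigma>0 (t + T) = \<sigma>0 t) \<and> (\<forall>\<sigma>\<in>S. ((\<lambda>t. norm (\<sigma> t - \<sigma>0 t)) \<longlongrightarrow> 0) at_top)"
  proof (rule ex_periodic_attractor[OF T_pos])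
    show "(\<lambda>t. \<sigma> (t + T)) \<in> S" if "\<sigma> \<in> S" for \<sigma>
      using that solution_shift unfolding S_def by blast
  next
    fix \<epsilon> :: real assume "\<epsilon> > 0"
    then obtain \<tau> where \<tau>: "\<And>\<sigma>1 P1 \<sigma>2 P2 t. solution \<sigma>1 P1 \<Longrightarrow> solution \<sigma>2 P2 \<Longrightarrow> t \<ge> \<tau> \<Longrightarrow>
        (\<Sum>i\<in>UNIV. \<bar>\<sigma>1 t $ i - \<sigma>2 t $ i\<bar>) \<le> \<epsilon>"
      using solutions_merge by meson
    have "norm (\<sigma>1 t - \<sigma>2 t) \<le> \<epsilon>" if "\<sigma>1 \<in> S" "\<sigma>2 \<in> S" "t \<ge> \<tau>" for \<sigma>1 \<sigma>2 t
    proof -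
      obtain P1 P2 where "solution \<sigma>1 P1" "solution \<sigma>2 P2" using \<open>\<sigma>1 \<in> S\<close> \<open>\<sigma>2 \<in> S\<close> unfolding S_def by blast
      then show ?thesis
        using \<tau>[of \<sigma>1 P1 \<sigma>2 P2 t] norm_le_l1_cart[of "\<sigma>1 t - \<sigma>2 t"] \<open>t \<ge> \<tau>\<close> by simp
    qed
    then show "\<exists>\<tau>. \<forall>\<sigma>1\<in>S. \<forall>\<sigma>2\<in>S. \<forall>t\<ge>\<tau>. norm (\<sigma>1 t - \<sigma>2 t) \<le> \<epsilon>" by blast
  qed
  then show ?thesis unfolding S_def by blast
qed

end

section \<open>Linear algebra of the network\<close>

lemma diag_mat_mult_vec: "diag_mat a *v x = (\<chi> i. a $ i * x $ i)"
  by (simp add: vec_eq_iff matrix_vector_mult_def diag_mat_def if_distrib[of "\<lambda>c. c * _"] cong: if_cong)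

lemma matrix_inv_diag_mat_mult_vec:
  assumes "\<And>i. a $ i \<noteq> 0"
  shows "matrix_inv (diag_mat a) *v y = (\<chi> i. y $ i / a $ i)"
proof -
  let ?B = "diag_mat (\<chi> i. 1 / a $ i)"
  have "diag_mat a ** ?B = mat 1" "?B ** diag_mat a = mat 1"
    using assms by (simp_all add: matrix_eq matrix_vector_mul_assoc[symmetric] diag_mat_mult_vec vec_eq_iff)
  then have "matrix_inv (diag_mat a) ** diag_mat a = mat 1"
    unfolding matrix_inv_def by (rule someI2[where a="?B", OF conjI]) blast
  then have "matrix_inv (diag_mat a) *v (diag_mat a *v (\<chi> i. y $ i / a $ i)) = (\<chi> i. y $ i / a $ i)"
    by (simp add: matrix_vector_mul_assoc)
  moreover have "diag_mat a *v (\<chi> i. y $ i / a $ i) = y"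
    using assms by (simp add: diag_mat_mult_vec vec_eq_iff)
  ultimately show ?thesis by simp
qed

lemma spaceV_diag_mat:
  assumes "\<And>i. a $ i > 0"
  shows "x \<in> spaceV (diag_mat a) (span {u}) \<longleftrightarrow> u \<bullet> (diag_mat a *v x) = 0"
proof
  have nz: "a $ i \<noteq> 0" for i using assms[of i] by simp
  have AA: "diag_mat a *v (matrix_inv (diag_mat a) *v y) = y" "matrix_inv (diag_mat a) *v (diag_mat a *v y) = y" for y
    using nz by (simp_all add: matrix_inv_diag_mat_mult_vec diag_mat_mult_vec vec_eq_iff)
  {
    assume "x \<in> spaceV (diag_mat a) (span {u})"
    then obtain y where y: "x = matrix_inv (diag_mat a) *v y" "\<forall>z\<in>span {u}. z \<bullet> y = 0"
      unfolding spaceV_def by auto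
    have "u \<in> span {u}" by (rule span_base) simp
    then show "u \<bullet> (diag_mat a *v x) = 0" using y AA(1) by simp
  }
  assume "u \<bullet> (diag_mat a *v x) = 0"
  then have "\<forall>z\<in>span {u}. z \<bullet> (diag_mat a *v x) = 0" by (auto simp: span_singleton)
  then show "x \<in> spaceV (diag_mat a) (span {u})"
    unfolding spaceV_def using AA(2)[of x] by (intro image_eqI[of _ _ "diag_mat a *v x"]) auto
qed

section \<open>Projections and norm of the energy inner product\<close>

lemma diag_mat_form_pos:
  assumes "\<And>i. a $ i > 0" "u \<noteq> 0"
  shows "u \<bullet> (diag_mat a *v u) > 0"
proof -
  obtain i where i: "u $ i \<noteq> 0" using \<open>u \<noteq> 0\<close> by (auto simp: vec_eq_iff)
  have "u \<bullet> (diag_mat a *v u) = (\<Sum>i\<in>UNIV. a $ i * (u $ i)\<^sup>2)"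
    by (simp add: inner_vec_def diag_mat_mult_vec power2_eq_square mult.left_commute)
  also have "\<dots> > 0"
    using assms(1) i by (intro sum_pos2[of _ i]) (auto simp: less_imp_le)
  finally show ?thesis .
qed

text \<open>\<open>\<kappa> x\<close> is the coefficient of \<open>u\<close> in the decomposition
  orthogonal for the inner product weighted by \<open>a\<close>. Positivity of the form at
  \<open>u\<close> makes it unique, as the definite descriptions in \<open>projU\<close> and
  \<open>projV\<close> require.\<close>

lemma
  assumes a: "\<And>i. a $ i > 0" and u: "u \<noteq> 0"
  defines "\<kappa> x \<equiv> (u \<bullet> (diag_mat a *v x)) / (u \<bullet> (diag_mat a *v u))"
  shows projU_span_singleton: "projU (span {u}) (spaceV (diag_mat a) (span {u})) x = \<kappa> x *\<^sub>R u"
    and projV_span_singleton: "projV (span {u}) (spaceV (diag_mat a) (span {u})) x = x - \<kappa> x *\<^sub>R u"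
proof -
  have w: "u \<bullet> (diag_mat a *v u) \<noteq> 0" using diag_mat_form_pos[OF a u] by simp
  have \<kappa>: "u \<bullet> (diag_mat a *v (x - c *\<^sub>R u)) = 0 \<longleftrightarrow> c = \<kappa> x" for c
    using w by (auto simp: \<kappa>_def matrix_vector_mult_diff_distrib matrix_vector_mult_scaleR inner_diff_right field_simps)
  have mem: "x - c *\<^sub>R u \<in> spaceV (diag_mat a) (span {u}) \<longleftrightarrow> c = \<kappa> x" for c
    unfolding spaceV_diag_mat[OF a] by (rule \<kappa>)
  show "projU (span {u}) (spaceV (diag_mat a) (span {u})) x = \<kappa> x *\<^sub>R u"
    unfolding projU_def
  proof (rule the_equality)
    show "\<kappa> x *\<^sub>R u \<in> span {u} \<and> x - \<kappa> x *\<^sub>R u \<in> spaceV (diag_mat a) (span {u})"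
      using mem by (auto simp: span_singleton)
  next
    fix y assume y: "y \<in> span {u} \<and> x - y \<in> spaceV (diag_mat a) (span {u})"
    then obtain c where "y = c *\<^sub>R u" by (auto simp: span_singleton)
    then show "y = \<kappa> x *\<^sub>R u" using y mem by auto
  qed
  show "projV (span {u}) (spaceV (diag_mat a) (span {u})) x = x - \<kappa> x *\<^sub>R u"
    unfolding projV_def
  proof (rule the_equality)
    show "x - \<kappa> x *\<^sub>R u \<in> spaceV (diag_mat a) (span {u}) \<and> x - (x - \<kappa> x *\<^sub>R u) \<in> span {u}"
      using mem by (auto simp: span_singleton)
  next
    fix y assume y: "y \<in> spaceV (diag_mat a) (span {u}) \<and> x - y \<in> span {u}"
    then obtain c where "x - y = c *\<^sub>R u" by (auto simp: span_singleton)
    then have "y = x - c *\<^sub>R u" by (simp add: algebra_simps)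
    then show "y = x - \<kappa> x *\<^sub>R u" using y mem by auto
  qed
qed

lemma normA_diag_mat:
  assumes "\<And>i. a $ i \<ge> 0"
  shows "normA (diag_mat a) x = L2_set (\<lambda>i. sqrt (a $ i) * x $ i) UNIV"
  using assms
  by (simp add: normA_def L2_set_def inner_vec_def diag_mat_mult_vec power_mult_distrib power2_eq_square ac_simps)

text \<open>Pythagoras for the energy inner product. It allows the projected loading in the
  hypothesis to be replaced by the loading itself plus any multiple of \<open>u\<close>.\<close>

lemma normA_le_add_orthogonal:
  assumes a: "\<And>i. a $ i > 0" and orth: "u \<bullet> (diag_mat a *v y) = 0"
  shows "normA (diag_mat a) y \<le> normA (diag_mat a) (y + c *\<^sub>R u)"
proof -
  have sym: "y \<bullet> (diag_mat a *v u) = u \<bullet> (diag_mat a *v y)"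
    by (simp add: inner_vec_def diag_mat_mult_vec ac_simps)
  have "u \<bullet> (diag_mat a *v u) \<ge> 0"
    using diag_mat_form_pos[OF a, of u] by (cases "u = 0") auto
  then have "0 \<le> c * (c * (u \<bullet> (diag_mat a *v u)))" by (simp add: mult.assoc[symmetric])
  then show ?thesis
    unfolding normA_def
    by (simp add: matrix_vector_right_distrib matrix_vector_mult_scaleR inner_add_left inner_add_right sym orth)
qed

section \<open>Kinematics and force balance of the network\<close>

lemma kin_matrix_mult_vec: "(kin_matrix ii jj *v \<xi>) $ k = \<xi> $ jj k - \<xi> $ ii k"
  by (simp add: kin_matrix_def matrix_vector_mult_def left_diff_distrib sum_subtractf
      if_distrib[of "\<lambda>c. c * _"] cong: if_cong)

lemma inner_transpose_mult_vec: "(transpose D *v x) \<bullet> \<xi> = x \<bullet> (D *v (\<xi> :: real^'n::finite))"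
  by (simp add: dot_lmul_matrix)

text \<open>Rank \<open>q\<close> leaves a plane of displacements compatible with zero displacement
  loads. The plane contains the constants, which \<open>D\<close> annihilates, so its image under
  \<open>D\<close> is a line.\<close>

lemma spaceU_eq_span:
  fixes ii jj :: "'m::finite \<Rightarrow> 'n::finite"
  assumes rank: "dim (span ((\<lambda>k. transpose (kin_matrix ii jj) *v R k) ` {..<q})) = q"
    and q: "q + 2 = CARD('n)"
    and u: "u \<in> spaceU (kin_matrix ii jj) R q" "u \<noteq> 0"
  shows "spaceU (kin_matrix ii jj) R q = span {u}"
proof -
  define D where "D = kin_matrix ii jj"
  define S where "S = span ((\<lambda>k. transpose D *v R k) ` {..<q})"
  define K where "K = {y \<in> UNIV. \<forall>x\<in>S. orthogonal x y}"
  have "dim K + dim S = CARD('n)"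
    unfolding K_def using dim_subspace_orthogonal_to_vectors[of S UNIV] by (simp add: S_def)
  then have dimK: "dim K = 2" using rank q by (simp add: S_def D_def)
  have K: "\<xi> \<in> K" if "\<forall>k<q. R k \<bullet> (D *v \<xi>) = 0" for \<xi>
  proof -
    have "orthogonal \<xi> x" if "x \<in> S" for x
      using that unfolding S_def
    proof (rule orthogonal_to_span)
      fix y assume "y \<in> (\<lambda>k. transpose D *v R k) ` {..<q}"
      then obtain k where "k < q" "y = transpose D *v R k" by auto
      then show "orthogonal \<xi> y"
        using \<open>\<forall>k<q. R k \<bullet> (D *v \<xi>) = 0\<close> inner_transpose_mult_vec[of D "R k" \<xi>]
        by (simp add: orthogonal_def inner_commute)
    qed
    then show ?thesis by (simp add: K_def orthogonal_commute)
  qed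
  have D1: "D *v (c *\<^sub>R 1) = 0" for c by (simp add: vec_eq_iff D_def kin_matrix_mult_vec)
  then have "D *v 1 = 0" by (metis scaleR_one)
  then have oneK: "1 \<in> K" by (intro K) simp
  obtain \<eta> where \<eta>: "u = D *v \<eta>" "\<forall>k<q. R k \<bullet> (D *v \<eta>) = 0"
    using u(1) unfolding spaceU_def D_def[symmetric] by auto
  have \<eta>_notin: "\<eta> \<notin> span {1}" using \<eta>(1) u(2) D1 by (auto simp: span_singleton)
  have "\<eta> \<noteq> 1" using \<eta>_notin by (auto simp: span_base)
  then have card: "card {\<eta>, 1} = 2" by simp
  have "independent {\<eta>, 1}"
    using \<eta>_notin \<open>\<eta> \<noteq> 1\<close> by (simp add: independent_insert dependent_single)
  then have K_span: "K \<subseteq> span {\<eta>, 1}"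
    using oneK K[OF \<eta>(2)] card dimK by (intro card_ge_dim_independent) auto
  have "x \<in> span {u}" if "x \<in> spaceU D R q" for x
  proof -
    obtain \<xi> where \<xi>: "x = D *v \<xi>" "\<forall>k<q. R k \<bullet> (D *v \<xi>) = 0"
      using \<open>x \<in> spaceU D R q\<close> unfolding spaceU_def by auto
    then have "\<xi> \<in> span {\<eta>, 1}" using K K_span by blast
    then obtain b c where "\<xi> - b *\<^sub>R \<eta> = c *\<^sub>R 1"
      by (auto simp: span_breakdown_eq span_singleton)
    then have "\<xi> = b *\<^sub>R \<eta> + c *\<^sub>R 1" by (simp add: algebra_simps)
    then have "x = b *\<^sub>R u"
      using \<xi>(1) \<eta>(1) D1 by (simp add: matrix_vector_right_distrib matrix_vector_mult_scaleR)
    then show ?thesis by (auto simp: span_singleton)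
  qed
  moreover have "c *\<^sub>R u \<in> spaceU D R q" for c
  proof -
    have "c *\<^sub>R u = D *v (c *\<^sub>R \<eta>)" by (simp add: \<eta>(1) matrix_vector_mult_scaleR)
    moreover have "\<forall>k<q. R k \<bullet> (c *\<^sub>R u) = 0" using \<eta> by simp
    ultimately show ?thesis unfolding spaceU_def by blast
  qed
  ultimately show ?thesis unfolding D_def[symmetric] by (auto simp: span_singleton)
qed

text \<open>The indicator function of the component of the left end of the spring in the graph of
  the displacement-controlled loadings is a displacement that yields an element of \<open>U\<close>.\<close>

lemma unblocked_imp_nonzero:
  fixes ii jj :: "'m::finite \<Rightarrow> 'n::finite"
  assumes chain: "\<forall>k<q. \<forall>\<xi>. R k \<bullet> (kin_matrix ii jj *v \<xi>) = \<xi> $ JJ k - \<xi> $ II k"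
    and U: "spaceU (kin_matrix ii jj) R q = span {u}"
    and unblocked: "\<not> blocked q II JJ ii jj i"
  shows "u $ i \<noteq> 0"
proof
  assume "u $ i = 0"
  define F where "F = (\<lambda>k. (II k, JJ k)) ` {..<q}"
  define \<chi>c where "\<chi>c = (\<chi> v. if (ii i, v) \<in> (F \<union> F\<inverse>)\<^sup>* then 1 else (0::real))"
  have "\<chi>c $ JJ k = \<chi>c $ II k" if "k < q" for k
  proof -
    have "(II k, JJ k) \<in> F \<union> F\<inverse>" "(JJ k, II k) \<in> F \<union> F\<inverse>" using that by (auto simp: F_def)
    then have "(ii i, JJ k) \<in> (F \<union> F\<inverse>)\<^sup>* \<longleftrightarrow> (ii i, II k) \<in> (F \<union> F\<inverse>)\<^sup>*"
      by (meson rtrancl.rtrancl_into_rtrancl)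
    then show ?thesis by (simp add: \<chi>c_def)
  qed
  then have "kin_matrix ii jj *v \<chi>c \<in> spaceU (kin_matrix ii jj) R q"
    using chain unfolding spaceU_def by auto
  then obtain c where "kin_matrix ii jj *v \<chi>c = c *\<^sub>R u" unfolding U by (auto simp: span_singleton)
  then have "(kin_matrix ii jj *v \<chi>c) $ i = 0" using \<open>u $ i = 0\<close> by simp
  then have "\<chi>c $ jj i = \<chi>c $ ii i" by (simp add: kin_matrix_mult_vec)
  then have "(ii i, jj i) \<in> (F \<union> F\<inverse>)\<^sup>*" by (simp add: \<chi>c_def split: if_splits)
  then show False using unblocked by (simp add: blocked_def F_def)
qed

text \<open>Equal ends would make one of the \<open>q\<close> spanning vectors zero. The case has to
  be excluded because \<open>load_vec\<close> is then a unit vector instead of the zero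
  vector.\<close>

lemma full_rank_imp_distinct_ends:
  fixes D :: "real^'n::finite^'m::finite"
  assumes rank: "dim (span ((\<lambda>k. transpose D *v R k) ` {..<q})) = q"
    and chain: "\<forall>k<q. \<forall>\<xi>. R k \<bullet> (D *v \<xi>) = \<xi> $ JJ k - \<xi> $ II k" and "k < q"
  shows "II k \<noteq> JJ k"
proof
  assume "II k = JJ k"
  then have "(transpose D *v R k) \<bullet> \<xi> = 0" for \<xi>
    using chain \<open>k < q\<close> by (simp add: inner_transpose_mult_vec del: transpose_matrix_vector)
  then have zero: "transpose D *v R k = 0" by (metis inner_eq_zero_iff)
  let ?f = "\<lambda>k. transpose D *v R k"
  have "?f ` {..<q} \<subseteq> insert 0 (?f ` ({..<q} - {k}))" using zero by auto
  then have "span (?f ` {..<q}) \<subseteq> span (?f ` ({..<q} - {k}))"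
    by (metis span_insert_0 span_mono)
  then have "dim (span (?f ` {..<q})) \<le> dim (span (?f ` ({..<q} - {k})))" by (rule dim_subset)
  also have "\<dots> \<le> card (?f ` ({..<q} - {k}))" by (simp add: dim_le_card')
  also have "\<dots> \<le> card ({..<q} - {k})" by (intro card_image_le) simp
  also have "\<dots> < q" using \<open>k < q\<close> by simp
  finally show False using rank by simp
qed

lemma inner_spring_vec:
  assumes "ii k \<noteq> jj k"
  shows "\<xi> \<bullet> spring_vec ii jj k = \<xi> $ ii k - \<xi> $ jj k"
proof -
  have "spring_vec ii jj k = axis (ii k) 1 - axis (jj k) 1"
    using assms by (auto simp: spring_vec_def axis_def vec_eq_iff)
  then show ?thesis by (simp add: inner_diff_right inner_axis)
qed

lemma inner_load_vec:
  assumes "II k \<noteq> JJ k"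
  shows "\<xi> \<bullet> load_vec II JJ k = \<xi> $ II k - \<xi> $ JJ k"
proof -
  have "load_vec II JJ k = axis (II k) 1 - axis (JJ k) 1"
    using assms by (auto simp: load_vec_def axis_def vec_eq_iff)
  then show ?thesis by (simp add: inner_diff_right inner_axis)
qed

text \<open>Virtual work: the balance is tested with a displacement whose elongation is
  \<open>u\<close>. The reactions do no work, since the two ends of each displacement loading move
  equally.\<close>

lemma equilibrium_orthogonal:
  assumes ends: "\<forall>k. ii k \<noteq> jj k"
    and chain: "\<forall>k<q. \<forall>\<xi>. R k \<bullet> (kin_matrix ii jj *v \<xi>) = \<xi> $ JJ k - \<xi> $ II k"
    and load_ends: "\<And>k. k < q \<Longrightarrow> II k \<noteq> JJ k"
    and u: "u \<in> spaceU (kin_matrix ii jj) R q"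
    and eq: "(\<Sum>k\<in>UNIV. s $ k *\<^sub>R spring_vec ii jj k) + (\<Sum>k<q. r k *\<^sub>R load_vec II JJ k)
            + (- (transpose (kin_matrix ii jj) *v h)) = 0"
  shows "u \<bullet> (s + h) = 0"
proof -
  obtain \<xi> where \<xi>: "u = kin_matrix ii jj *v \<xi>" and R: "\<forall>k<q. R k \<bullet> (kin_matrix ii jj *v \<xi>) = 0"
    using u unfolding spaceU_def by auto
  have "0 = \<xi> \<bullet> ((\<Sum>k\<in>UNIV. s $ k *\<^sub>R spring_vec ii jj k) + (\<Sum>k<q. r k *\<^sub>R load_vec II JJ k)
            + (- (transpose (kin_matrix ii jj) *v h)))" unfolding eq by simp
  also have "\<dots> = (\<Sum>k\<in>UNIV. s $ k * (\<xi> \<bullet> spring_vec ii jj k)) + (\<Sum>k<q. r k * (\<xi> \<bullet> load_vec II JJ k))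
            - \<xi> \<bullet> (transpose (kin_matrix ii jj) *v h)"
    by (simp add: inner_add_right inner_sum_right inner_diff_right del: transpose_matrix_vector)
  also have "(\<Sum>k\<in>UNIV. s $ k * (\<xi> \<bullet> spring_vec ii jj k)) = - (u \<bullet> s)"
  proof -
    have "u \<bullet> s = (\<Sum>k\<in>UNIV. - (s $ k * (\<xi> \<bullet> spring_vec ii jj k)))"
      using ends by (simp add: \<xi> inner_vec_def[of _ s] kin_matrix_mult_vec inner_spring_vec algebra_simps)
    then show ?thesis by (simp add: sum_negf)
  qed
  also have "(\<Sum>k<q. r k * (\<xi> \<bullet> load_vec II JJ k)) = 0"
  proof (rule sum.neutral, intro ballI)
    fix k assume "k \<in> {..<q}"
    then have "\<xi> \<bullet> load_vec II JJ k = 0"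
      using R chain load_ends by (simp add: inner_load_vec)
    then show "r k * (\<xi> \<bullet> load_vec II JJ k) = 0" by simp
  qed
  also have "\<xi> \<bullet> (transpose (kin_matrix ii jj) *v h) = u \<bullet> h"
    using inner_transpose_mult_vec[of "kin_matrix ii jj" h \<xi>] by (simp add: \<xi> inner_commute)
  finally show ?thesis by (simp add: inner_add_right)
qed

text \<open>The inequality is tested with points of the box that differ from \<open>x\<close> in a
  single coordinate.\<close>

lemma normal_cone_box:
  assumes "\<zeta> \<in> normal_cone (box cm cp) x"
  shows normal_cone_box_mem: "cm $ j \<le> x $ j" "x $ j \<le> cp $ j"
    and normal_cone_box_pos: "\<zeta> $ j > 0 \<Longrightarrow> x $ j = cp $ j"
    and normal_cone_box_neg: "\<zeta> $ j < 0 \<Longrightarrow> x $ j = cm $ j"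
proof -
  have x: "\<forall>i. cm $ i \<le> x $ i \<and> x $ i \<le> cp $ i" and le: "\<And>c. c \<in> box cm cp \<Longrightarrow> \<zeta> \<bullet> (c - x) \<le> 0"
    using assms by (auto simp: normal_cone_def box_def split: if_splits)
  show mem: "cm $ j \<le> x $ j" "x $ j \<le> cp $ j" using x by auto
  have test: "\<zeta> $ j * (c - x $ j) \<le> 0" if c: "cm $ j \<le> c" "c \<le> cp $ j" for c
  proof -
    define y where "y = (\<chi> i. if i = j then c else x $ i)"
    have "y \<in> box cm cp" using x c by (auto simp: y_def box_def)
    then have "\<zeta> \<bullet> (y - x) \<le> 0" by (rule le)
    moreover have "y - x = axis j (c - x $ j)" by (auto simp: y_def axis_def vec_eq_iff)
    ultimately show ?thesis by (simp add: inner_axis)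
  qed
  have "cm $ j \<le> cp $ j" using mem by simp
  then show "\<zeta> $ j > 0 \<Longrightarrow> x $ j = cp $ j" "\<zeta> $ j < 0 \<Longrightarrow> x $ j = cm $ j"
    using test[of "cp $ j"] test[of "cm $ j"] mem by (auto simp: mult_le_0_iff)
qed

section \<open>Reduction of the network to the moving simplex\<close>

theorem theorem7:
  fixes ii jj :: "'m::finite \<Rightarrow> 'n::finite"
    and a cm cp :: "real^'m"
    and q :: nat and II JJ :: "nat \<Rightarrow> 'n"
    and R :: "nat \<Rightarrow> real^'m" and L :: "nat \<Rightarrow> real^'n"
    and l :: "real \<Rightarrow> nat \<Rightarrow> real" and hbar :: "real \<Rightarrow> real^'m"
    and T :: real and ubar :: "real^'m"
  defines "D \<equiv> kin_matrix ii jj"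
    and "A \<equiv> diag_mat a"
    and "U \<equiv> spaceU (kin_matrix ii jj) R q"
    and "V \<equiv> spaceV (diag_mat a) (spaceU (kin_matrix ii jj) R q)"
  assumes ends: "\<forall>k. ii k \<noteq> jj k"
    and conn: "graph_connected ii jj"
    and apos: "\<forall>i. a $ i > 0"
    and clim: "\<forall>i. cm $ i < cp $ i"
    and Rinc: "\<forall>k<q. \<forall>i. R k $ i \<in> {-1, 0, 1}"
    and Rchain: "\<forall>k<q. \<forall>\<xi>. R k \<bullet> (D *v \<xi>) = \<xi> $ JJ k - \<xi> $ II k"
    and rank: "dim (span ((\<lambda>k. transpose D *v R k) ` {..<q})) = q"
    and Ldef: "\<forall>k<q. \<forall>k'<q. R k \<bullet> (D *v L k') = (if k = k' then 1 else 0)"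
    and hcont: "continuous_on UNIV hbar"
    and qdim: "q = CARD('n) - 2"
    and unblocked: "\<forall>k. \<not> blocked q II JJ ii jj k"
    and Tpos: "T > 0"
    and lper: "\<forall>t. \<forall>k<q. l (t + T) k = l t k"
    and hper: "\<forall>t. hbar (t + T) = hbar t"
    and llip: "\<exists>K. \<forall>t t'. \<forall>k<q. \<bar>l t k - l t' k\<bar> \<le> K * \<bar>t - t'\<bar>"
    and hlip: "\<exists>K. K-lipschitz_on UNIV hbar"
    and ubarU: "ubar \<in> U" and ubar0: "ubar \<noteq> 0"
    and stress_large: "\<exists>k\<in>{-1, 1::real}. \<forall>j. \<forall>t\<in>{0..T}.
        (ubar \<bullet> ((\<chi> i. if i = j then cbar cm cp ubar (- k) $ i else cbar cm cp ubar k $ i)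
                   + A *v projU U V (matrix_inv A *v hbar t)))
      * (ubar \<bullet> (cbar cm cp ubar k + A *v projU U V (matrix_inv A *v hbar t))) \<le> 0"
    and disp_large: "\<exists>t1 t2. 0 \<le> t1 \<and> t1 < t2 \<and>
        normA A (matrix_inv A *v cm - matrix_inv A *v cp)
          < normA A (projV U V (D *v (\<Sum>k<q. l t1 k *\<^sub>R L k))
                     - projV U V (D *v (\<Sum>k<q. l t2 k *\<^sub>R L k)))"
  shows "\<exists>s0 :: real \<Rightarrow> real^'m. (\<forall>t\<ge>0. s0 (t + T) = s0 t) \<and>
           (\<forall>s e p r. is_solution ii jj a cm cp q II JJ R l hbar s e p r \<longrightarrow>
              ((\<lambda>t. norm (s t - s0 t)) \<longlongrightarrow> 0) at_top)"
proof -
  have a: "a $ i > 0" for i using apos by blast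
  \<comment> \<open>There is at least one spring, and its two distinct ends give two nodes, so the
    subtraction of naturals in \<open>qdim\<close> is not truncated.\<close>
  obtain k0 :: 'm where True by blast
  have "2 = card {ii k0, jj k0}" using ends by simp
  also have "\<dots> \<le> CARD('n)" by (intro card_mono) auto
  finally have q2: "q + 2 = CARD('n)" using qdim by simp
  obtain k :: real where k: "k = 1 \<or> k = -1" and stress: "\<And>j t. t \<in> {0..T} \<Longrightarrow>
        (ubar \<bullet> ((\<chi> i. if i = j then cbar cm cp ubar (- k) $ i else cbar cm cp ubar k $ i)
                   + A *v projU U V (matrix_inv A *v hbar t)))
      * (ubar \<bullet> (cbar cm cp ubar k + A *v projU U V (matrix_inv A *v hbar t))) \<le> 0"
    using stress_large by blast
  obtain t1 t2 where t12: "0 \<le> t1" "t1 < t2" and gap: "normA A (matrix_inv A *v cm - matrix_inv A *v cp)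
          < normA A (projV U V (D *v (\<Sum>k<q. l t1 k *\<^sub>R L k)) - projV U V (D *v (\<Sum>k<q. l t2 k *\<^sub>R L k)))"
    using disp_large by blast
  have kk: "k * k = 1" using k by auto
  \<comment> \<open>The sign \<open>k\<close> is moved into the spanning vector; the vertex
    \<open>c\<close> below then maximizes the inner product with \<open>u\<close> over the
    box.\<close>
  define u where "u = k *\<^sub>R ubar"
  have u0: "u \<noteq> 0" using ubar0 k by (auto simp: u_def)
  have "U = span {ubar}"
    unfolding U_def using spaceU_eq_span[OF _ q2 _ ubar0] rank ubarU by (simp only: D_def U_def)
  then have "u \<in> U" by (auto simp: u_def span_singleton)
  then have Uu: "spaceU (kin_matrix ii jj) R q = span {u}"
    using spaceU_eq_span[OF _ q2 _ u0] rank by (simp only: D_def U_def)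
  have ubar_u: "ubar \<bullet> x = k * (u \<bullet> x)" for x using kk by (simp add: u_def mult.assoc[symmetric])
  have un: "u $ j \<noteq> 0" for j
    using Rchain unblocked by (intro unblocked_imp_nonzero[OF _ Uu]) (auto simp: D_def)
  define c where "c = cbar cm cp ubar k"
  have c: "c $ j = (if u $ j > 0 then cp $ j else cm $ j)"
    and c': "cbar cm cp ubar (- k) $ j = (if u $ j > 0 then cm $ j else cp $ j)" for j
    using k un[of j] by (auto simp: c_def cbar_def u_def sgn_if)
  \<comment> \<open>With \<open>s = A e\<close> and \<open>e = G + m u - p\<close>, factoring
    \<open>a $ j * (u $ j)\<^sup>2\<close> out of \<open>u $ j * (c $ j - s $ j)\<close> produces
    \<open>\<beta>\<close> and \<open>\<gamma>\<close>. \<open>W j\<close> is the value of this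
    coordinate at the opposite elastic limit, and \<open>\<rho>\<close> is the sum of the
    coordinates under force balance.\<close>
  define \<beta> where "\<beta> j = a $ j * (u $ j)\<^sup>2" for j
  define W where "W j = \<bar>u $ j\<bar> * (cp $ j - cm $ j)" for j
  define G where "G t = D *v (\<Sum>k<q. l t k *\<^sub>R L k)" for t
  define \<gamma> where "\<gamma> t j = G t $ j / u $ j - c $ j / (u $ j * a $ j)" for t j
  define \<rho> where "\<rho> t = u \<bullet> c + u \<bullet> hbar t" for t
  have \<beta>: "\<beta> j > 0" for j using a[of j] un[of j] by (simp add: \<beta>_def)
  have Wc: "u $ j * (c $ j - cbar cm cp ubar (- k) $ j) = W j" for j
    by (simp add: W_def c c' abs_if algebra_simps)
  \<comment> \<open>The part removed by \<open>projU\<close> lies in \<open>V\<close>, so its image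
    under \<open>A\<close> is orthogonal to \<open>u\<close>.\<close>
  have projU: "u \<bullet> (A *v projU U V (matrix_inv A *v x)) = u \<bullet> x" for x
  proof -
    have "A *v (matrix_inv A *v x) = x"
      unfolding A_def using a by (simp add: matrix_inv_diag_mat_mult_vec less_imp_neq[symmetric] diag_mat_mult_vec vec_eq_iff)
    then show ?thesis
      using diag_mat_form_pos[OF a u0] unfolding U_def V_def Uu projU_span_singleton[OF a u0]
      by (simp add: A_def matrix_vector_mult_scaleR)
  qed
  \<comment> \<open>The stress hypothesis and the compactness bound on \<open>G\<close> cover one
    period; periodicity extends them to all nonnegative times.\<close>
  have reduce: "\<exists>t' n. 0 \<le> t' \<and> t' \<le> T \<and> t = t' + real n * T" if "t \<ge> 0" for t
  proof -
    define n where "n = nat \<lfloor>t / T\<rfloor>"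
    have n: "real n = of_int \<lfloor>t / T\<rfloor>" using that Tpos by (simp add: n_def)
    have "real n \<le> t / T" "t / T \<le> real n + 1" unfolding n by linarith+
    then have "real n * T \<le> t" "t \<le> real n * T + T" using Tpos by (simp_all add: field_simps)
    then show ?thesis by (intro exI[of _ "t - real n * T"] exI[of _ n]) auto
  qed
  have hper': "hbar (t + real n * T) = hbar t" for t n
  proof (induction n)
    case (Suc n)
    have "hbar (t + real (Suc n) * T) = hbar ((t + real n * T) + T)" by (simp add: algebra_simps)
    then show ?case using hper Suc by simp
  qed simp
  have Gper: "G (t + T) = G t" for t using lper by (simp add: G_def)
  have Gper': "G (t + real n * T) = G t" for t n
  proof (induction n)
    case (Suc n)
    have "G (t + real (Suc n) * T) = G ((t + real n * T) + T)" by (simp add: algebra_simps)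
    then show ?case using Gper Suc by simp
  qed simp
  have \<rho>_le: "\<rho> t \<le> W j" if t0: "t \<ge> 0" for t j
  proof -
    obtain t' n where t': "0 \<le> t'" "t' \<le> T" "t = t' + real n * T" using reduce[OF t0] by blast
    define f where "f = (\<chi> i. if i = j then cbar cm cp ubar (- k) $ i else c $ i)"
    have "c - f = axis j (c $ j - cbar cm cp ubar (- k) $ j)" by (auto simp: f_def axis_def vec_eq_iff)
    then have "u \<bullet> (c - f) = W j" using Wc[of j] by (simp add: inner_axis)
    then have flip: "u \<bullet> f = u \<bullet> c - W j" by (simp add: inner_diff_right)
    \<comment> \<open>Moving spring \<open>j\<close> to its other limit lowers the inner product
      with \<open>u\<close> by \<open>W j\<close>. As \<open>W j > 0\<close>, the sign of the
      product places \<open>\<rho> t'\<close> between 0 and \<open>W j\<close>.\<close>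
    have "k * (u \<bullet> f + u \<bullet> hbar t') * (k * (u \<bullet> c + u \<bullet> hbar t')) \<le> 0"
      using stress[of t' j] t' unfolding c_def[symmetric] f_def[symmetric] ubar_u inner_add_right projU by (simp add: distrib_left)
    then have "(k * k) * ((\<rho> t' - W j) * \<rho> t') \<le> 0" by (simp add: flip \<rho>_def algebra_simps)
    then have prod: "(\<rho> t' - W j) * \<rho> t' \<le> 0" by (simp add: kk)
    have "W j > 0" using un[of j] clim by (simp add: W_def)
    then have "\<rho> t' \<le> W j" using prod by (auto simp: mult_le_0_iff)
    then show ?thesis by (simp add: \<rho>_def t'(3) hper')
  qed
  obtain K where K: "\<And>t t' k. k < q \<Longrightarrow> \<bar>l t k - l t' k\<bar> \<le> K * \<bar>t - t'\<bar>" using llip by blast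
  have l_cont: "continuous_on UNIV (\<lambda>t. l t k)" if "k < q" for k
  proof (rule lipschitz_on_continuous_on)
    show "\<bar>K\<bar>-lipschitz_on UNIV (\<lambda>t. l t k)"
    proof (rule lipschitz_onI)
      fix t t' :: real
      have "K * \<bar>t - t'\<bar> \<le> \<bar>K\<bar> * \<bar>t - t'\<bar>" by (intro mult_right_mono) auto
      then show "dist (l t k) (l t' k) \<le> \<bar>K\<bar> * dist t t'" using K[OF that, of t t'] by (simp add: dist_real_def)
    qed simp
  qed
  have G_cont: "continuous_on UNIV G"
    unfolding G_def by (intro continuous_intros l_cont bounded_linear.continuous_on[OF matrix_vector_mul_bounded_linear]) auto
  have "bounded (G ` {0..T})"
    by (intro compact_imp_bounded compact_continuous_image continuous_on_subset[OF G_cont]) auto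
  then obtain B where B: "\<And>t. t \<in> {0..T} \<Longrightarrow> norm (G t) \<le> B"
    unfolding bounded_iff by blast
  define \<Gamma> where "\<Gamma> = (\<Sum>j\<in>UNIV. \<bar>B\<bar> / \<bar>u $ j\<bar> + \<bar>c $ j / (u $ j * a $ j)\<bar>)"
  have \<gamma>_bound: "\<bar>\<gamma> t j\<bar> \<le> \<Gamma>" if t0: "t \<ge> 0" for t j
  proof -
    obtain t' n where t': "0 \<le> t'" "t' \<le> T" "t = t' + real n * T" using reduce[OF t0] by blast
    have "\<bar>G t $ j\<bar> \<le> \<bar>B\<bar>"
      using B[of t'] component_le_norm_cart[of "G t'" j] t' Gper' by force
    then have "\<bar>G t $ j / u $ j\<bar> \<le> \<bar>B\<bar> / \<bar>u $ j\<bar>" by (simp add: abs_divide divide_right_mono)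
    then have "\<bar>\<gamma> t j\<bar> \<le> \<bar>B\<bar> / \<bar>u $ j\<bar> + \<bar>c $ j / (u $ j * a $ j)\<bar>" unfolding \<gamma>_def by linarith
    also have "\<dots> \<le> \<Gamma>" unfolding \<Gamma>_def by (rule member_le_sum) auto
    finally show ?thesis .
  qed
  define c0 where "c0 = normA A (projV U V (G t1) - projV U V (G t2))
      - normA A (matrix_inv A *v cm - matrix_inv A *v cp)"
  have c0: "c0 > 0" using gap by (simp add: c0_def G_def)
  have anz: "a $ i \<noteq> 0" for i using a[of i] by simp
  \<comment> \<open>The entries of \<open>u\<close> cancel: both sides are the root of the sum of
    \<open>(cp $ j - cm $ j)\<^sup>2 / a $ j\<close>.\<close>
  have diam: "L2_set (\<lambda>j. W j / sqrt (\<beta> j)) UNIV = normA A (matrix_inv A *v cm - matrix_inv A *v cp)"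
  proof -
    have "(W j / sqrt (\<beta> j))\<^sup>2 = (sqrt (a $ j) * (cm $ j / a $ j - cp $ j / a $ j))\<^sup>2" for j
    proof -
      have "(W j / sqrt (\<beta> j))\<^sup>2 = (u $ j)\<^sup>2 * (cp $ j - cm $ j)\<^sup>2 / (a $ j * (u $ j)\<^sup>2)"
        using \<beta>[of j] by (simp add: power_divide W_def power_mult_distrib \<beta>_def)
      also have "\<dots> = (cp $ j - cm $ j)\<^sup>2 / a $ j" using un[of j] by simp
      also have "\<dots> = a $ j * ((cm $ j - cp $ j) / a $ j)\<^sup>2"
        using a[of j] by (simp add: power2_eq_square) (simp add: algebra_simps)
      finally show ?thesis using a[of j] by (simp add: power_mult_distrib diff_divide_distrib)
    qed
    then show ?thesis
      unfolding A_def by (simp add: normA_diag_mat less_imp_le a matrix_inv_diag_mat_mult_vec anz L2_set_def)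
  qed
  \<comment> \<open>The right-hand side is the energy norm of
    \<open>G t2 - G t1 + z *\<^sub>R u\<close>, which differs from the projected increment
    \<open>y\<close> by a multiple of \<open>u\<close>, whatever \<open>z\<close> is.\<close>
  have large: "c0 + L2_set (\<lambda>j. W j / sqrt (\<beta> j)) UNIV
      \<le> L2_set (\<lambda>j. sqrt (\<beta> j) * (\<gamma> t2 j - \<gamma> t1 j + z)) UNIV" for z
  proof -
    define \<kappa> where "\<kappa> x = (u \<bullet> (diag_mat a *v x)) / (u \<bullet> (diag_mat a *v u))" for x
    define y where "y = projV U V (G t2) - projV U V (G t1)"
    have PV: "projV U V x = x - \<kappa> x *\<^sub>R u" for x
      unfolding U_def V_def Uu projV_span_singleton[OF a u0] \<kappa>_def ..
    have orth: "u \<bullet> (diag_mat a *v (x - \<kappa> x *\<^sub>R u)) = 0" for x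
      using diag_mat_form_pos[OF a u0]
      by (simp add: \<kappa>_def matrix_vector_mult_diff_distrib matrix_vector_mult_scaleR inner_diff_right)
    have y0: "u \<bullet> (diag_mat a *v y) = 0"
      unfolding y_def PV matrix_vector_mult_diff_distrib[of _ "_ - _" "_ - _"] inner_diff_right[of _ "_ *v _" "_ *v _"] orth by simp
    have "c0 + L2_set (\<lambda>j. W j / sqrt (\<beta> j)) UNIV = normA A (- y)" by (simp add: diam c0_def y_def)
    also have "\<dots> = normA A y" by (simp add: normA_def A_def diag_mat_mult_vec inner_vec_def)
    also have "\<dots> \<le> normA A (y + (z + (\<kappa> (G t2) - \<kappa> (G t1))) *\<^sub>R u)"
      unfolding A_def by (rule normA_le_add_orthogonal[OF a y0])
    also have "y + (z + (\<kappa> (G t2) - \<kappa> (G t1))) *\<^sub>R u = G t2 - G t1 + z *\<^sub>R u"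
      by (simp add: y_def PV algebra_simps)
    also have "normA A (G t2 - G t1 + z *\<^sub>R u) = L2_set (\<lambda>j. sqrt (\<beta> j) * (\<gamma> t2 j - \<gamma> t1 j + z)) UNIV"
    proof -
      have "(sqrt (a $ j) * (G t2 - G t1 + z *\<^sub>R u) $ j)\<^sup>2 = (sqrt (\<beta> j) * (\<gamma> t2 j - \<gamma> t1 j + z))\<^sup>2" for j
      proof -
        have "u $ j * (\<gamma> t2 j - \<gamma> t1 j + z) = (G t2 - G t1 + z *\<^sub>R u) $ j"
          using un[of j] by (simp add: \<gamma>_def field_simps)
        then have "(sqrt (a $ j) * (G t2 - G t1 + z *\<^sub>R u) $ j)\<^sup>2 = a $ j * (u $ j * (\<gamma> t2 j - \<gamma> t1 j + z))\<^sup>2"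
          using a[of j] by (simp only: power_mult_distrib[of "sqrt (a $ j)"]) simp
        also have "\<dots> = (sqrt (\<beta> j) * (\<gamma> t2 j - \<gamma> t1 j + z))\<^sup>2"
          using \<beta>[of j] by (simp add: power_mult_distrib less_imp_le \<beta>_def)
        finally show ?thesis .
      qed
      then show ?thesis unfolding A_def by (simp add: normA_diag_mat less_imp_le a L2_set_def)
    qed
    finally show ?thesis .
  qed
  interpret simplex_sweeping \<beta> W \<gamma> \<rho> T t1 t2 c0 \<Gamma>
    by unfold_locales (use \<beta> \<rho>_le \<gamma>_bound Tpos Gper hper t12 c0 large in \<open>auto simp: \<gamma>_def \<rho>_def\<close>)
  define scal where "scal x = (\<chi> j. x $ j / u $ j)" for x :: "real^'m"
  have "linear scal" by (rule linearI) (simp_all add: scal_def vec_eq_iff add_divide_distrib)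
  then have scal: "bounded_linear scal" by (simp add: linear_conv_bounded_linear)
  have load_ends: "II k \<noteq> JJ k" if "k < q" for k
    using full_rank_imp_distinct_ends[OF rank Rchain that] .
  have red: "solution (\<lambda>t. \<chi> j. u $ j * (c $ j - s t $ j)) (\<lambda>t. scal (p t))"
    if sol: "is_solution ii jj a cm cp q II JJ R l hbar s e p r" for s e p r
  proof -
    have AC: "abs_cont_on 0 b s" "abs_cont_on 0 b e" "abs_cont_on 0 b p" if "b \<ge> 0" for b
      using sol that by (auto simp: is_solution_def Let_def)
    have "AE t in lebesgue. t \<ge> 0 \<longrightarrow>
          s t = A *v e t \<and>
          p differentiable (at t) \<and>
          vector_derivative p (at t) \<in> normal_cone (box cm cp) (s t) \<and>
          (\<exists>\<xi>. e t + p t = D *v \<xi>) \<and>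
          (\<forall>k<q. R k \<bullet> (e t + p t) = l t k) \<and>
          (\<Sum>k\<in>UNIV. s t $ k *\<^sub>R spring_vec ii jj k) + (\<Sum>k<q. r t k *\<^sub>R load_vec II JJ k)
            + (- (transpose D *v hbar t)) = 0"
      using sol unfolding is_solution_def Let_def A_def D_def by (rule conjunct2)
    then obtain N where N: "negligible N" and rel: "\<And>t. t \<ge> 0 \<Longrightarrow> t \<notin> N \<Longrightarrow>
          s t = A *v e t \<and>
          p differentiable (at t) \<and>
          vector_derivative p (at t) \<in> normal_cone (box cm cp) (s t) \<and>
          (\<exists>\<xi>. e t + p t = D *v \<xi>) \<and>
          (\<forall>k<q. R k \<bullet> (e t + p t) = l t k) \<and>
          (\<Sum>k\<in>UNIV. s t $ k *\<^sub>R spring_vec ii jj k) + (\<Sum>k<q. r t k *\<^sub>R load_vec II JJ k)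
            + (- (transpose D *v hbar t)) = 0"
      by (rule AE_lebesgue_negligibleE) (rule that)
    have cont [continuous_intros]: "continuous_on {0..} s" "continuous_on {0..} e" "continuous_on {0..} p"
      using AC by (auto intro: abs_cont_on_all_imp_continuous_on)
    have cont' [continuous_intros]: "continuous_on {0..} G" "continuous_on {0..} hbar"
      using G_cont hcont continuous_on_subset by blast+
    have s_e: "s t $ j = a $ j * e t $ j" if "t \<ge> 0" for t j
    proof -
      have "s t $ j - a $ j * e t $ j = 0"
        by (rule AE_zero_imp_zero[OF _ N _ that])
          (use rel in \<open>auto intro!: continuous_intros simp: A_def diag_mat_mult_vec\<close>)
      then show ?thesis by simp
    qed
    \<comment> \<open>The coefficient of \<open>u\<close> is read off by a Euclidean projection
      instead of being chosen at each time; this makes it continuous, so that the relation below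
      extends to every time.\<close>
    define m where "m t = (u \<bullet> (e t + p t - G t)) / (u \<bullet> u)" for t
    have e_p: "e t $ j = G t $ j + m t * u $ j - p t $ j" if "t \<ge> 0" for t j
    proof -
      have "e t $ j + p t $ j - G t $ j - m t * u $ j = 0"
      proof (rule AE_zero_imp_zero[OF _ N _ that])
        show "continuous_on {0..} (\<lambda>t. e t $ j + p t $ j - G t $ j - m t * u $ j)"
          unfolding m_def using u0 by (intro continuous_intros) auto
        fix t assume t: "t \<ge> 0" "t \<notin> N"
        obtain \<xi> where \<xi>: "e t + p t = D *v \<xi>" using rel[OF t] by blast
        \<comment> \<open>By the choice of \<open>L\<close>, the elongation \<open>G t\<close>
          already realizes the prescribed displacements; the remainder lies in
          \<open>U\<close>.\<close>
        have "R k \<bullet> (e t + p t - G t) = 0" if "k < q" for k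
        proof -
          have "R k \<bullet> G t = (\<Sum>k'<q. l t k' * (R k \<bullet> (D *v L k')))"
            by (simp add: G_def linear_sum[OF matrix_vector_mul_linear] matrix_vector_mult_scaleR inner_sum_right)
          also have "\<dots> = (\<Sum>k'<q. if k = k' then l t k' else 0)"
            using Ldef that by (intro sum.cong) auto
          also have "\<dots> = l t k" using that by simp
          finally show ?thesis using rel[OF t] that by (simp add: inner_diff_right)
        qed
        moreover have "e t + p t - G t = D *v (\<xi> - (\<Sum>k<q. l t k *\<^sub>R L k))"
          by (simp add: \<xi> G_def matrix_vector_mult_diff_distrib)
        ultimately have "e t + p t - G t \<in> span {u}"
          unfolding Uu[symmetric] spaceU_def D_def by blast
        then obtain b where b: "e t + p t - G t = b *\<^sub>R u" by (auto simp: span_singleton)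
        then have "m t = b" using u0 by (simp add: m_def)
        then show "e t $ j + p t $ j - G t $ j - m t * u $ j = 0"
          using arg_cong[OF b, of "\<lambda>x. x $ j"] by simp
      qed
      then show ?thesis by simp
    qed
    have bal: "u \<bullet> (s t + hbar t) = 0" if "t \<ge> 0" for t
    proof (rule AE_zero_imp_zero[OF _ N _ that])
      show "continuous_on {0..} (\<lambda>t. u \<bullet> (s t + hbar t))" by (intro continuous_intros)
      fix t assume t: "t \<ge> 0" "t \<notin> N"
      show "u \<bullet> (s t + hbar t) = 0"
      proof (rule equilibrium_orthogonal[OF ends Rchain[unfolded D_def]])
        show "II k \<noteq> JJ k" if "k < q" for k using load_ends[OF that] .
        show "u \<in> spaceU (kin_matrix ii jj) R q" using \<open>u \<in> U\<close> by (simp only: U_def)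
        show "(\<Sum>k\<in>UNIV. s t $ k *\<^sub>R spring_vec ii jj k) + (\<Sum>k<q. r t k *\<^sub>R load_vec II JJ k)
            + (- (transpose (kin_matrix ii jj) *v hbar t)) = 0"
          using rel[OF t] unfolding D_def by blast
      qed
    qed
    have cone: "vector_derivative p (at t) \<in> normal_cone (box cm cp) (s t)" if "t \<ge> 0" "t \<notin> N" for t
      using rel[OF that] by blast
    have s_lo: "cm $ j \<le> s t $ j" if "t \<ge> 0" for t j
    proof -
      have "s t $ j - cm $ j \<ge> 0"
        by (rule AE_nonneg_imp_nonneg[OF _ N _ that])
          (auto intro!: continuous_intros normal_cone_box_mem(1)[OF cone])
      then show ?thesis by simp
    qed
    have s_hi: "s t $ j \<le> cp $ j" if "t \<ge> 0" for t j
    proof -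
      have "cp $ j - s t $ j \<ge> 0"
        by (rule AE_nonneg_imp_nonneg[OF _ N _ that])
          (auto intro!: continuous_intros normal_cone_box_mem(2)[OF cone])
      then show ?thesis by simp
    qed
    define \<sigma> where "\<sigma> t = (\<chi> j. u $ j * (c $ j - s t $ j))" for t
    have \<sigma>_nonneg: "0 \<le> \<sigma> t $ j" if "t \<ge> 0" for t j
      using s_lo[OF that, of j] s_hi[OF that, of j] un[of j] by (auto simp: \<sigma>_def c mult_nonpos_nonpos)
    have \<sigma>_sum: "(\<Sum>j\<in>UNIV. \<sigma> t $ j) = \<rho> t" if "t \<ge> 0" for t
      using bal[OF that] by (simp add: \<sigma>_def \<rho>_def inner_vec_def right_diff_distrib sum_subtractf sum.distrib distrib_left)
    have \<sigma>_eq: "\<sigma> t $ j = \<beta> j * (scal (p t) $ j - \<gamma> t j - m t)" if "t \<ge> 0" for t j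
    proof -
      have "\<beta> j * (scal (p t) $ j - \<gamma> t j - m t) = u $ j * c $ j - u $ j * (a $ j * (G t $ j + m t * u $ j - p t $ j))"
        using un[of j] a[of j] by (simp add: \<beta>_def scal_def \<gamma>_def power2_eq_square field_simps)
      then show ?thesis by (simp add: \<sigma>_def s_e[OF that] e_p[OF that, symmetric] right_diff_distrib)
    qed
    have AC_scal: "abs_cont_on 0 b (\<lambda>t. scal (p t))" if "b \<ge> 0" for b
    proof -
      obtain C where "\<And>x. norm (scal x) \<le> norm x * C" using bounded_linear.bounded[OF scal] by blast
      then show ?thesis
        using bounded_linear.linear[OF scal]
        by (intro abs_cont_on_dominated[OF AC(3)[OF that], of _ C]) (simp add: linear_diff[symmetric] mult.commute)
    qed
    have rate: "\<exists>\<pi>. ((\<lambda>t. scal (p t)) has_vector_derivative \<pi>) (at t) \<and>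
        (\<forall>j. (\<pi> $ j > 0 \<longrightarrow> \<sigma> t $ j = 0) \<and> (\<pi> $ j < 0 \<longrightarrow> (\<forall>i. i \<noteq> j \<longrightarrow> \<sigma> t $ i = 0)))"
      if t: "t \<ge> 0" "t \<notin> N" for t
    proof -
      define \<zeta> where "\<zeta> = vector_derivative p (at t)"
      have \<zeta>: "\<zeta> \<in> normal_cone (box cm cp) (s t)" "(p has_vector_derivative \<zeta>) (at t)"
        using rel[OF t] by (auto simp: \<zeta>_def vector_derivative_works[symmetric])
      have 1: "((\<lambda>t. scal (p t)) has_vector_derivative scal \<zeta>) (at t)"
        by (rule bounded_linear.has_vector_derivative[OF scal \<zeta>(2)])
      have 2: "\<sigma> t $ j = 0" if "scal \<zeta> $ j > 0" for j
        using that normal_cone_box_pos[OF \<zeta>(1), of j] normal_cone_box_neg[OF \<zeta>(1), of j] un[of j]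
        by (auto simp: scal_def \<sigma>_def c zero_less_divide_iff)
      \<comment> \<open>At the opposite limit coordinate \<open>j\<close> equals \<open>W j\<close>,
        which is at least the whole sum \<open>\<rho> t\<close>; nothing is left for the other
        coordinates.\<close>
      have 3: "\<sigma> t $ i = 0" if neg: "scal \<zeta> $ j < 0" "i \<noteq> j" for i j
      proof -
        have "\<sigma> t $ j = W j"
          using neg normal_cone_box_pos[OF \<zeta>(1), of j] normal_cone_box_neg[OF \<zeta>(1), of j] un[of j]
          by (auto simp: scal_def \<sigma>_def c W_def divide_less_0_iff abs_if algebra_simps)
        moreover have "\<sigma> t $ j + \<sigma> t $ i \<le> \<rho> t"
        proof -
          have "(\<Sum>l\<in>{i, j}. \<sigma> t $ l) \<le> (\<Sum>l\<in>UNIV. \<sigma> t $ l)"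
            using \<sigma>_nonneg[OF t(1)] by (intro sum_mono2) auto
          then show ?thesis using neg(2) \<sigma>_sum[OF t(1)] by simp
        qed
        ultimately show ?thesis using \<rho>_le[OF t(1), of j] \<sigma>_nonneg[OF t(1), of i] by linarith
      qed
      show ?thesis by (intro exI[of _ "scal \<zeta>"] conjI allI impI 1) (fact 2, fact 3)
    qed
    have "solution \<sigma> (\<lambda>t. scal (p t))"
      unfolding solution_def
    proof (intro conjI)
      show "\<forall>b\<ge>0. abs_cont_on 0 b (\<lambda>t. scal (p t))" using AC_scal by simp
      show "\<exists>m. \<forall>t\<ge>0. \<forall>j. \<sigma> t $ j = \<beta> j * (scal (p t) $ j - \<gamma> t j - m t)"
        using \<sigma>_eq by (intro exI[of _ m]) simp
      show "\<forall>t\<ge>0. (\<forall>j. 0 \<le> \<sigma> t $ j) \<and> (\<Sum>j\<in>UNIV. \<sigma> t $ j) = \<rho> t"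
        using \<sigma>_nonneg \<sigma>_sum by simp
    qed (intro exI[of _ N] conjI allI impI N rate)
    then show ?thesis by (simp add: \<sigma>_def[abs_def])
  qed
  obtain \<sigma>0 where \<sigma>0: "\<And>t. \<sigma>0 (t + T) = \<sigma>0 t"
    "\<And>\<sigma> P. solution \<sigma> P \<Longrightarrow> ((\<lambda>t. norm (\<sigma> t - \<sigma>0 t)) \<longlongrightarrow> 0) at_top"
    using ex_periodic_attracting_solution by blast
  show ?thesis
  \<comment> \<open>The witness solves \<open>\<sigma> $ j = u $ j * (c $ j - s $ j)\<close> for the
    stress.\<close>
  proof (intro exI[of _ "\<lambda>t. c - scal (\<sigma>0 t)"] conjI allI impI)
    show "c - scal (\<sigma>0 (t + T)) = c - scal (\<sigma>0 t)" for t by (simp add: \<sigma>0(1))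
    fix s e p r assume sol: "is_solution ii jj a cm cp q II JJ R l hbar s e p r"
    have "((\<lambda>t. (\<chi> j. u $ j * (c $ j - s t $ j)) - \<sigma>0 t) \<longlongrightarrow> 0) at_top"
      using \<sigma>0(2)[OF red[OF sol]] by (rule tendsto_norm_zero_cancel)
    then have "((\<lambda>t. scal ((\<chi> j. u $ j * (c $ j - s t $ j)) - \<sigma>0 t)) \<longlongrightarrow> 0) at_top"
      by (rule bounded_linear.tendsto_zero[OF scal])
    then have "((\<lambda>t. norm (scal ((\<chi> j. u $ j * (c $ j - s t $ j)) - \<sigma>0 t))) \<longlongrightarrow> 0) at_top"
      by (rule tendsto_norm_zero)
    moreover have "scal ((\<chi> j. u $ j * (c $ j - s t $ j)) - \<sigma>0 t) = - (s t - (c - scal (\<sigma>0 t)))" for t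
      using un by (simp add: scal_def vec_eq_iff diff_divide_distrib)
    ultimately show "((\<lambda>t. norm (s t - (c - scal (\<sigma>0 t)))) \<longlongrightarrow> 0) at_top"
      by (simp only: norm_minus_cancel)
  qed
qed

end
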